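(* Let $N_1,\dots,N_k\ge1$ be integers and $L\in\{1,2,\dots,\max(N_1,\dots,N_k)\}$. For a positive integer $N$ let $r_1,\dots,r_{\varphi(N)}$ be the integers in $\{1,\dots,N\}$ coprime to $N$, let $C_N=N^{\varphi(N)}\prod_{p\mid N}p^{\varphi(N)/(p-1)}$ (product over primes $p$ dividing $N$), and $$\mathbf B_N(m)=C_N^m\prod_{j=1}^{\varphi(N)}\frac{(r_j/N)_m}{m!}\qquad(m\ge0).$$ Define $$\mathbf F_{\mathbf N}(z)=\sum_{m=0}^\infty\Big(\prod_{j=1}^k\mathbf B_{N_j}(m)\Big)z^m,\qquad \mathbf G_{L,\mathbf N}(z)=\sum_{m=1}^\infty H_{Lm}\Big(\prod_{j=1}^k\mathbf B_{N_j}(m)\Big)z^m.$$ Then $\mathbf q_{L,\mathbf N}(z):=\exp\big(\mathbf G_{L,\mathbf N}(z)/\mathbf F_{\mathbf N}(z)\big)\in\mathbb{Z}[[z]]$.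
   Context: $\varphi$ is Euler's totient function; $(\alpha)_m=\alpha(\alpha+1)\cdots(\alpha+m-1)$ for $m\ge1$ and $(\alpha)_0=1$; $H_n=\sum_{i=1}^n1/i$. The numbers $\mathbf B_N(m)$ are integers, so $\mathbf F_{\mathbf N}(z)\in1+z\mathbb{Z}[[z]]$. *)

theory Defs
  imports "HOL-Analysis.Analysis" "HOL-Number_Theory.Number_Theory"
begin

unbundle fps_syntax

text \<open>
  The exponent \<open>totient N div (p - 1)\<close> is an exact quotient for every prime \<open>p\<close> dividing \<open>N\<close>;
  see \<open>diff_one_dvd_totient\<close>.
\<close>

definition C_coeff :: "nat \<Rightarrow> nat" where
  "C_coeff N = N ^ totient N * (\<Prod>p\<in>prime_factors N. p ^ (totient N div (p - 1)))"

lemma diff_one_dvd_totient: "p \<in> prime_factors N \<Longrightarrow> p - 1 dvd totient N"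
  by (metis in_prime_factors_iff totient_dvd totient_prime)

definition B_coeff :: "nat \<Rightarrow> nat \<Rightarrow> real" where
  "B_coeff N m = real (C_coeff N) ^ m * (\<Prod>r\<in>totatives N. pochhammer (real r / real N) m / fact m)"

definition F_fps :: "nat \<Rightarrow> (nat \<Rightarrow> nat) \<Rightarrow> real fps" where
  "F_fps k N = Abs_fps (\<lambda>m. \<Prod>j=1..k. B_coeff (N j) m)"

text \<open>Below, the constant term vanishes because \<open>harm 0 = 0\<close>, so the sum effectively starts at 1.\<close>

definition G_fps :: "nat \<Rightarrow> nat \<Rightarrow> (nat \<Rightarrow> nat) \<Rightarrow> real fps" where
  "G_fps L k N = Abs_fps (\<lambda>m. harm (L * m) * (\<Prod>j=1..k. B_coeff (N j) m))"

text \<open>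
  Division and composition of formal power series are total operations; they have their usual
  meaning here because \<open>F_fps\<close> has constant term 1 and \<open>G_fps / F_fps\<close> has constant term 0.
\<close>

definition q_fps :: "nat \<Rightarrow> nat \<Rightarrow> (nat \<Rightarrow> nat) \<Rightarrow> real fps" where
  "q_fps L k N = fps_exp 1 oo (G_fps L k N / F_fps k N)"

lemma F_fps_nth_0: "F_fps k N $ 0 = 1"
  by (simp add: F_fps_def B_coeff_def)

lemma G_fps_nth_0: "G_fps L k N $ 0 = 0"
  by (simp add: G_fps_def harm_def)

lemma G_div_F_fps_nth_0: "(G_fps L k N / F_fps k N) $ 0 = 0"
  by (simp add: fps_divide_unit F_fps_nth_0 G_fps_nth_0)

end

theory Submission
  imports Defs "HOL-Computational_Algebra.Formal_Laurent_Series"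
begin

text \<open>
  It suffices to show, for every prime \<open>p\<close>, that the coefficients are \<open>p\<close>-integral. Put
  \<open>B m = (\<Prod>j. B_coeff (N j) m)\<close> and \<open>w m = harm (L * m)\<close>. By the criterion of Dieudonne and Dwork,
  this follows if the coefficients of \<open>F(z) G(z^p) - p F(z^p) G(z)\<close> are divisible by \<open>p\<close>.
  Since \<open>p * harm n \<equiv> harm (n div p)\<close>, the coefficient at \<open>a + p * K\<close> (with \<open>a < p\<close>) is, modulo \<open>p\<close>,
  \<open>\<Sum>j\<le>K. B (a + p * j) * B (K - j) * (w (K - j) - w j)\<close>.

  For \<open>v < p\<close> the ratio \<open>B (v + p * m) / B m\<close> is \<open>p\<close>-integral, and as a function of \<open>m\<close> it
  changes by a multiple of \<open>p ^ (s + 1)\<close> when \<open>m\<close> increases by \<open>p ^ s\<close>. With \<open>f\<close> this ratio for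
  \<open>v = a\<close>, the sum above equals \<open>- (\<Sum>j\<le>K. w j * B j * B (K - j) * (f j - f (K - j)))\<close>. By Dwork's
  congruence, the sum of \<open>B j * B (K - j) * (f j - f (K - j))\<close> over a block
  \<open>m * p ^ s \<le> j < (m + 1) * p ^ s\<close> is divisible by \<open>p ^ (s + 1) * B m\<close>. Expanding \<open>w j\<close> into a
  telescoping sum of the differences \<open>w (p ^ s * m) - w (p ^ (s + 1) * (m div p))\<close>, it
  remains to see that these become \<open>p\<close>-integral when multiplied by \<open>p ^ s * B m\<close>. This is a
  bound for the \<open>p\<close>-adic valuation of \<open>B m\<close>, and the only place where \<open>L \<le> Max (N ` {1..k})\<close>
  is used.
\<close>

subsection \<open>p-integral numbers and congruences of Dwork type\<close>

locale prime_place =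
  fixes p :: nat
  assumes prime_p: "prime p"
begin

lemma p_pos: "p > 0"
  using prime_p by (simp add: prime_gt_0_nat)

lemma p_gt_1: "p > 1"
  using prime_p by (simp add: prime_gt_Suc_0_nat)

text \<open>The localization of the integers at \<open>p\<close>, realized inside the reals because
  the coefficients are real. A denominator \<open>b\<close> is automatically nonzero, as
  \<open>p\<close> divides 0.\<close>

definition Zp :: "real set" where
  "Zp = {x. \<exists>(a::int) (b::nat). \<not> p dvd b \<and> x = of_int a / of_nat b}"

lemma ZpI: "\<not> p dvd b \<Longrightarrow> of_int a / of_nat b \<in> Zp"
  unfolding Zp_def by blast

lemma Zp_of_int [simp, intro]: "of_int a \<in> Zp"
  using ZpI[of 1 a] p_gt_1 by simp

lemma Zp_of_nat [simp, intro]: "of_nat a \<in> Zp"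
  using Zp_of_int[of "int a"] by simp

lemma Zp_0 [simp, intro]: "0 \<in> Zp"
  using Zp_of_nat[of 0] by simp

lemma Zp_1 [simp, intro]: "1 \<in> Zp"
  using Zp_of_nat[of 1] by simp

lemma Zp_add [intro]:
  assumes "x \<in> Zp" "y \<in> Zp"
  shows "x + y \<in> Zp"
proof -
  obtain a b c d where *: "\<not> p dvd b" "x = of_int a / of_nat b"
    "\<not> p dvd d" "y = of_int c / of_nat d"
    using assms unfolding Zp_def by blast
  from * have "b \<noteq> 0" "d \<noteq> 0"
    by (auto intro!: Nat.gr0I)
  have "x + y = of_int (a * int d + c * int b) / of_nat (b * d)"
    using * \<open>b \<noteq> 0\<close> \<open>d \<noteq> 0\<close> by (simp add: field_simps)
  moreover have "\<not> p dvd b * d"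
    using * prime_p by (simp add: prime_dvd_mult_iff)
  ultimately show ?thesis
    using ZpI by presburger
qed

lemma Zp_mult [intro]:
  assumes "x \<in> Zp" "y \<in> Zp"
  shows "x * y \<in> Zp"
proof -
  obtain a b c d where *: "\<not> p dvd b" "x = of_int a / of_nat b"
    "\<not> p dvd d" "y = of_int c / of_nat d"
    using assms unfolding Zp_def by blast
  have "x * y = of_int (a * c) / of_nat (b * d)"
    using * by simp
  moreover have "\<not> p dvd b * d"
    using * prime_p by (simp add: prime_dvd_mult_iff)
  ultimately show ?thesis
    using ZpI by presburger
qed

lemma Zp_minus [intro]: "x \<in> Zp \<Longrightarrow> - x \<in> Zp"
  using Zp_mult[OF Zp_of_int[of "- 1"], of x] by simp

lemma Zp_diff [intro]: "x \<in> Zp \<Longrightarrow> y \<in> Zp \<Longrightarrow> x - y \<in> Zp"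
  using Zp_add[of x "- y"] by auto

lemma Zp_sum [intro]: "(\<And>i. i \<in> A \<Longrightarrow> f i \<in> Zp) \<Longrightarrow> sum f A \<in> Zp"
  by (induction A rule: infinite_finite_induct) auto

lemma Zp_prod [intro]: "(\<And>i. i \<in> A \<Longrightarrow> f i \<in> Zp) \<Longrightarrow> prod f A \<in> Zp"
  by (induction A rule: infinite_finite_induct) auto

lemma Zp_power [intro]: "x \<in> Zp \<Longrightarrow> x ^ n \<in> Zp"
  by (induction n) auto

lemma Zp_inverse_nat: "\<not> p dvd b \<Longrightarrow> 1 / real b \<in> Zp"
  using ZpI[of b 1] by simp

lemma Zp_divide_nat: "x \<in> Zp \<Longrightarrow> \<not> p dvd b \<Longrightarrow> x / real b \<in> Zp"
  using Zp_mult[OF _ Zp_inverse_nat, of x b] by simp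

text \<open>The fractional ideal generated by \<open>x\<close>. Allowing any real generator permits
  congruences modulo \<open>p ^ s * B m\<close>, where the valuation of \<open>B m\<close> is left
  open.\<close>

definition ideal :: "real \<Rightarrow> real set" where
  "ideal x = (\<lambda>c. x * c) ` Zp"

lemma idealI: "c \<in> Zp \<Longrightarrow> x * c \<in> ideal x"
  unfolding ideal_def by blast

lemma idealE:
  assumes "y \<in> ideal x"
  obtains c where "c \<in> Zp" "y = x * c"
  using assms unfolding ideal_def by blast

lemma ideal_1 [simp]: "ideal 1 = Zp"
  by (simp add: ideal_def)

lemma ideal_0 [simp, intro]: "0 \<in> ideal x"
  using idealI[of 0 x] by simp

lemma ideal_add [intro]: "y \<in> ideal x \<Longrightarrow> z \<in> ideal x \<Longrightarrow> y + z \<in> ideal x"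
  by (metis (no_types, opaque_lifting) Zp_add distrib_left idealE idealI)

lemma ideal_minus [intro]: "y \<in> ideal x \<Longrightarrow> - y \<in> ideal x"
  by (metis Zp_minus idealE idealI mult_minus_right)

lemma ideal_diff [intro]: "y \<in> ideal x \<Longrightarrow> z \<in> ideal x \<Longrightarrow> y - z \<in> ideal x"
  using ideal_add[of y x "- z"] by auto

lemma ideal_sum [intro]: "(\<And>i. i \<in> A \<Longrightarrow> f i \<in> ideal x) \<Longrightarrow> sum f A \<in> ideal x"
  by (induction A rule: infinite_finite_induct) auto

lemma ideal_scale [intro]: "c \<in> Zp \<Longrightarrow> y \<in> ideal x \<Longrightarrow> c * y \<in> ideal x"
  by (metis Zp_mult idealE idealI mult.left_commute)

lemma ideal_scale' [intro]: "c \<in> Zp \<Longrightarrow> y \<in> ideal x \<Longrightarrow> y * c \<in> ideal x"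
  using ideal_scale[of c y x] by (simp add: mult.commute)

lemma ideal_mult_left: "y \<in> ideal x \<Longrightarrow> z * y \<in> ideal (z * x)"
  by (auto simp: ideal_def mult.assoc)

lemma ideal_p_cancel: "real p * y \<in> ideal (real p * x) \<Longrightarrow> y \<in> ideal x"
  using p_pos by (auto elim!: idealE simp: mult.assoc intro!: idealI)

lemma cong_ideal:
  assumes "[a = b] (mod p ^ t)"
  shows "real a - real b \<in> ideal (real p ^ t)"
proof -
  have "[int a = int b] (mod int (p ^ t))"
    using assms by (simp only: cong_int_iff)
  then obtain k where "int a - int b = int (p ^ t) * k"
    by (meson cong_iff_dvd_diff dvd_def)
  hence "of_int (int a - int b) = (of_int (int (p ^ t) * k) :: real)"
    by simp
  hence "real a - real b = real p ^ t * of_int k"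
    by simp
  thus ?thesis
    by (simp add: idealI)
qed

text \<open>
  Maps with \<open>lip 0 f\<close> are the 1-Lipschitz ones for the \<open>p\<close>-adic metric. The ratios
  \<open>B (v + p * m) / B m\<close> gain one more power of \<open>p\<close>, that is, satisfy \<open>lip 1\<close>.
\<close>

definition lip :: "nat \<Rightarrow> (nat \<Rightarrow> real) \<Rightarrow> bool" where
  "lip d f \<longleftrightarrow> (\<forall>m. f m \<in> Zp) \<and> (\<forall>m s. f (m + p ^ s) - f m \<in> ideal (real p ^ (s + d)))"

lemma lip_Zp: "lip d f \<Longrightarrow> f m \<in> Zp"
  by (simp add: lip_def)

lemma lip_diff: "lip d f \<Longrightarrow> f (m + p ^ s) - f m \<in> ideal (real p ^ (s + d))"
  by (simp add: lip_def)

lemma lip_const: "c \<in> Zp \<Longrightarrow> lip d (\<lambda>_. c)"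
  by (simp add: lip_def)

lemma lip_mult:
  assumes "lip d f" "lip d g"
  shows "lip d (\<lambda>x. f x * g x)"
proof -
  have "f (m + p ^ s) * g (m + p ^ s) - f m * g m
    = f (m + p ^ s) * (g (m + p ^ s) - g m) + g m * (f (m + p ^ s) - f m)" for m s
    by (simp add: algebra_simps)
  thus ?thesis
    using assms unfolding lip_def by (auto intro!: ideal_add ideal_scale)
qed

lemma lip_prod:
  "(\<And>i. i \<in> A \<Longrightarrow> lip d (f i)) \<Longrightarrow> lip d (\<lambda>x. \<Prod>i\<in>A. f i x)"
  by (induction A rule: infinite_finite_induct) (auto intro!: lip_mult lip_const)

text \<open>Moving \<open>x\<close> by \<open>p ^ s\<close> moves \<open>v + p * x\<close> by
  \<open>p ^ (s + 1)\<close>; this is the source of the gained power of \<open>p\<close>.\<close>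

lemma lip_0_affine:
  assumes "lip 0 f"
  shows "lip 1 (\<lambda>x. f (v + p * x))"
proof -
  have "f (v + p * (m + p ^ s)) - f (v + p * m) \<in> ideal (real p ^ (s + 1))" for m s
    using lip_diff[OF assms, of "v + p * m" "s + 1"] by (simp add: algebra_simps)
  thus ?thesis
    using assms by (simp add: lip_def)
qed

text \<open>The case \<open>s = 0\<close> makes consecutive values congruent modulo
  \<open>p\<close>, so \<open>(f x - f 0) / p\<close> is \<open>p\<close>-integral; the division
  uses up the extra power of \<open>p\<close>.\<close>

lemma lip_1_decompose:
  assumes "lip 1 f"
  obtains c g where "c \<in> Zp" "lip 0 g" "\<And>x. f x = c + real p * g x"
proof
  define g where "g x = (f x - f 0) / real p" for x
  have p: "real p \<noteq> 0"
    using p_pos by simp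
  show "f 0 \<in> Zp"
    using assms by (simp add: lip_Zp)
  show "f x = f 0 + real p * g x" for x
    using p by (simp add: g_def)
  have "f x - f 0 \<in> ideal (real p * 1)" for x
  proof (induction x)
    case (Suc x)
    have "f (Suc x) - f x \<in> ideal (real p * 1)"
      using lip_diff[OF assms, of x 0] by simp
    from ideal_add[OF this Suc] show ?case
      by simp
  qed auto
  hence 1: "g x \<in> Zp" for x
    using p ideal_p_cancel[of "g x" 1] by (simp add: g_def)
  have "real p * (g (m + p ^ s) - g m) = f (m + p ^ s) - f m" for m s
    using p by (simp add: g_def field_simps)
  hence "real p * (g (m + p ^ s) - g m) \<in> ideal (real p * real p ^ s)" for m s
    using lip_diff[OF assms, of m s] by simp
  hence "g (m + p ^ s) - g m \<in> ideal (real p ^ s)" for m s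
    by (rule ideal_p_cancel)
  with 1 show "lip 0 g"
    by (simp add: lip_def)
qed

end

section \<open>Sequences with Lipschitz ratios and Dwork's congruence\<close>

locale dwork_sequence = prime_place +
  fixes B :: "nat \<Rightarrow> real" and R :: "nat \<Rightarrow> nat \<Rightarrow> real"
  assumes B_0: "B 0 \<in> Zp"
    and R_lip: "v < p \<Longrightarrow> lip 1 (R v)"
    and B_rec: "v < p \<Longrightarrow> B (v + p * m) = R v m * B m"
begin

lemma B_Zp: "B n \<in> Zp"
proof (induction n rule: less_induct)
  case (less n)
  show ?case
  proof (cases "n = 0")
    case False
    have "B n = B (n mod p + p * (n div p))"
      by simp
    also have "\<dots> = R (n mod p) (n div p) * B (n div p)"
      by (rule B_rec) (simp add: p_pos)
    finally show ?thesis
      using less[of "n div p"] False p_gt_1 p_pos lip_Zp[OF R_lip] by auto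
  qed (simp add: B_0)
qed

text \<open>The numbers that become \<open>m\<close> when their last \<open>s\<close>
  base-\<open>p\<close> digits are deleted.\<close>

definition block :: "nat \<Rightarrow> nat \<Rightarrow> nat set" where
  "block s m = {m * p ^ s..<(m + 1) * p ^ s}"

text \<open>A piece of a convolution sum. The test \<open>j \<le> K\<close> excludes the indices at
  which the natural subtraction \<open>K - j\<close> would truncate to 0.\<close>

definition pair_sum :: "(nat \<Rightarrow> nat \<Rightarrow> real) \<Rightarrow> nat \<Rightarrow> nat \<Rightarrow> nat \<Rightarrow> real" where
  "pair_sum u K s m = (\<Sum>j\<in>block s m. if j \<le> K then B j * B (K - j) * u j (K - j) else 0)"

text \<open>The antisymmetrization of \<open>f x * g y\<close>. The kernel
  \<open>f j - f (K - j)\<close> of the application is the case where \<open>g\<close> is constantly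
  1, but the induction leaves that case.\<close>

definition alternating :: "(nat \<Rightarrow> real) \<Rightarrow> (nat \<Rightarrow> real) \<Rightarrow> nat \<Rightarrow> nat \<Rightarrow> real" where
  "alternating f g x y = f x * g y - g x * f y"

lemma pair_sum_add: "pair_sum (\<lambda>x y. u x y + w x y) K s m = pair_sum u K s m + pair_sum w K s m"
  unfolding pair_sum_def by (simp add: distrib_left if_distrib flip: sum.distrib cong: if_cong)

lemma pair_sum_scale: "pair_sum (\<lambda>x y. c * u x y) K s m = c * pair_sum u K s m"
  unfolding pair_sum_def by (simp add: sum_distrib_left if_distrib mult_ac cong: if_cong)

lemma pair_sum_sum: "pair_sum (\<lambda>x y. \<Sum>i\<in>A. u i x y) K s m = (\<Sum>i\<in>A. pair_sum (u i) K s m)"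
proof (induction A rule: infinite_finite_induct)
  case (insert a A)
  thus ?case by (simp add: pair_sum_add)
qed (auto simp: pair_sum_def intro!: sum.neutral)

text \<open>Insert \<open>f = c + p * f'\<close> and \<open>g = d + p * g'\<close>: the products
  \<open>c * d\<close> cancel by antisymmetry, and everything left has a factor \<open>p\<close> in
  front of kernels built from \<open>lip 0\<close> functions.\<close>

lemma pair_sum_alternating_lip_1:
  assumes lip_0: "\<And>f g. lip 0 f \<Longrightarrow> lip 0 g \<Longrightarrow> pair_sum (alternating f g) K s m \<in> ideal x"
    and "lip 1 f" "lip 1 g"
  shows "pair_sum (alternating f g) K s m \<in> ideal (real p * x)"
proof -
  obtain c f' where f': "c \<in> Zp" "lip 0 f'" "\<And>x. f x = c + real p * f' x"
    using lip_1_decompose[OF assms(2)] by blast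
  obtain d g' where g': "d \<in> Zp" "lip 0 g'" "\<And>x. g x = d + real p * g' x"
    using lip_1_decompose[OF assms(3)] by blast
  have "alternating f g = (\<lambda>x y. real p * (c * alternating (\<lambda>_. 1) g' x y + (d * alternating f' (\<lambda>_. 1) x y
      + real p * alternating f' g' x y)))"
    by (intro ext) (simp add: alternating_def f' g' algebra_simps)
  hence "pair_sum (alternating f g) K s m = real p * (c * pair_sum (alternating (\<lambda>_. 1) g') K s m
      + (d * pair_sum (alternating f' (\<lambda>_. 1)) K s m + real p * pair_sum (alternating f' g') K s m))"
    by (simp add: pair_sum_scale pair_sum_add)
  thus ?thesis
    using f' g' by (auto intro!: ideal_mult_left ideal_add ideal_scale lip_0 lip_const)
qed

lemma sum_block_Suc:
  "(\<Sum>j\<in>block (Suc s) m. h j) = (\<Sum>j\<in>block s m. \<Sum>v<p. h (v + p * j))"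
proof -
  have "(\<Sum>j\<in>block s m. \<Sum>v<p. h (v + p * j)) = (\<Sum>(j,v)\<in>block s m \<times> {..<p}. h (v + p * j))"
    by (rule sum.cartesian_product)
  also have "\<dots> = (\<Sum>j\<in>block (Suc s) m. h j)"
  proof (rule sum.reindex_bij_witness[of _ "\<lambda>j. (j div p, j mod p)" "\<lambda>(j,v). v + p * j"])
    fix a assume "a \<in> block (Suc s) m"
    hence "m * p ^ s * p \<le> a" "a < (m + 1) * p ^ s * p"
      by (auto simp: block_def mult_ac)
    hence "m * p ^ s \<le> a div p" "a div p < (m + 1) * p ^ s"
      using p_pos by (auto simp: less_eq_div_iff_mult_less_eq div_less_iff_less_mult)
    thus "(a div p, a mod p) \<in> block s m \<times> {..<p}"
      using p_pos by (auto simp: block_def)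
  next
    fix b assume "b \<in> block s m \<times> {..<p}"
    then obtain j v where b: "b = (j, v)" "j \<ge> m * p ^ s" "j + 1 \<le> (m + 1) * p ^ s" "v < p"
      by (auto simp: block_def)
    have "p * (m * p ^ s) \<le> p * j" "p * (j + 1) \<le> p * ((m + 1) * p ^ s)"
      using b mult_le_mono2 by blast+
    thus "(case b of (j, v) \<Rightarrow> v + p * j) \<in> block (Suc s) m"
      using b by (auto simp: block_def algebra_simps intro: trans_le_add2)
  qed (auto simp: p_pos)
  finally show ?thesis ..
qed

text \<open>
  Dwork's congruence, by induction on \<open>s\<close>: write \<open>j = v + p * j'\<close> and \<open>K = a + p * K'\<close>. The
  substitution \<open>v \<mapsto> a - v\<close> (or \<open>v \<mapsto> p + a - v\<close> after a borrow) in the subtracted part of the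
  kernel turns the sum into one over alternating kernels again, whose factors have gained a
  power of \<open>p\<close>.
\<close>

lemma dwork_congruence:
  "lip 0 f \<Longrightarrow> lip 0 g \<Longrightarrow> pair_sum (alternating f g) K s m \<in> ideal (real p ^ s * B m)"
proof (induction s arbitrary: f g K)
  case 0
  have block: "block 0 m = {m}"
    by (auto simp: block_def)
  show ?case
    unfolding pair_sum_def alternating_def block using 0
    by (auto simp: mult.assoc intro!: idealI Zp_mult B_Zp Zp_diff lip_Zp[OF 0(1)] lip_Zp[OF 0(2)])
next
  case (Suc s)
  define a where "a = K mod p"
  define K' where "K' = K div p"
  have K: "K = a + p * K'" and a: "a < p"
    using p_pos by (auto simp: a_def K'_def)
  \<comment> \<open>Absorbing the ratio gives
    \<open>B (v + p * x) * f (v + p * x) = B x * F v x\<close>, so the sum over the last digit again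
    has weights \<open>B j * B (K' - j)\<close>.\<close>
  define F where "F v x = R v x * f (v + p * x)" for v x
  define G where "G v x = R v x * g (v + p * x)" for v x
  have F: "lip 1 (F v)" and G: "lip 1 (G v)" if "v < p" for v
    unfolding F_def G_def by (intro lip_mult R_lip lip_0_affine that Suc.prems)+
  have IH: "pair_sum (alternating (F v) (G w)) K s m \<in> ideal (real p * (real p ^ s * B m))"
    if "v < p" "w < p" for v w K
    using pair_sum_alternating_lip_1[OF Suc.IH F[OF that(1)] G[OF that(2)]] .
  define h where "h j = (if j \<le> K then B j * B (K - j) * alternating f g j (K - j) else 0)" for j
  have *: "B j * B i * alternating f g j i = B j' * B i' * (F v j' * G w i' - G v j' * F w i')"
    if "j = v + p * j'" "i = w + p * i'" "v < p" "w < p" for j i j' i' v w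
    unfolding that(1,2) B_rec[OF that(3)] B_rec[OF that(4)] alternating_def F_def G_def
    by (simp add: algebra_simps)
  have low: "(\<Sum>v\<le>a. h (v + p * j)) = (if j \<le> K' then B j * B (K' - j) *
      (\<Sum>v\<le>a. alternating (F v) (G (a - v)) j (K' - j)) else 0)" for j
  proof (cases "j \<le> K'")
    case True
    then obtain i where i: "K' = j + i"
      using le_Suc_ex by blast
    have "h (v + p * j) = B j * B i * (F v j * G (a - v) i - G v j * F (a - v) i)" if "v \<le> a" for v
    proof -
      have le: "v + p * j \<le> K" and K_diff: "K - (v + p * j) = (a - v) + p * i"
        using that by (auto simp: K i algebra_simps)
      have "h (v + p * j) = B (v + p * j) * B (K - (v + p * j)) * alternating f g (v + p * j) (K - (v + p * j))"
        using le by (simp add: h_def)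
      thus ?thesis
        using *[OF refl K_diff, of v j] that a by simp
    qed
    hence "(\<Sum>v\<le>a. h (v + p * j)) = B j * B i * ((\<Sum>v\<le>a. F v j * G (a - v) i) - (\<Sum>v\<le>a. G v j * F (a - v) i))"
      by (simp add: sum_distrib_left sum_subtractf right_diff_distrib)
    also have "(\<Sum>v\<le>a. G v j * F (a - v) i) = (\<Sum>v\<le>a. G (a - v) j * F v i)"
      by (rule sum.reindex_bij_witness[of _ "\<lambda>v. a - v" "\<lambda>v. a - v"]) auto
    finally show ?thesis
      by (simp add: i alternating_def sum_subtractf)
  next
    case False
    hence "p * (K' + 1) \<le> p * j"
      by (intro mult_le_mono2) simp
    hence "\<not> v + p * j \<le> K" for v
      using a by (simp add: K)
    thus ?thesis
      using False by (simp add: h_def)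
  qed
  \<comment> \<open>For digits \<open>v > a\<close> the subtraction borrows:
    \<open>K - (v + p * j) = (p + a - v) + p * (K' - 1 - j)\<close>. With \<open>K' = 0\<close>
    there is nothing to borrow from and all terms vanish; this case is separate because
    \<open>K' - 1\<close> would truncate.\<close>
  have high: "(\<Sum>v\<in>{a<..<p}. h (v + p * j)) = (if K' = 0 then 0 else if j \<le> K' - 1 then B j * B (K' - 1 - j) *
      (\<Sum>v\<in>{a<..<p}. alternating (F v) (G (p + a - v)) j (K' - 1 - j)) else 0)" for j
  proof (cases "K' \<noteq> 0 \<and> j \<le> K' - 1")
    case True
    hence "j + 1 \<le> K'"
      by linarith
    then obtain i where i: "K' = j + 1 + i"
      using le_Suc_ex by blast
    have "h (v + p * j) = B j * B i * (F v j * G (p + a - v) i - G v j * F (p + a - v) i)"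
      if "v \<in> {a<..<p}" for v
    proof -
      have less: "p + a - v < p"
        using that by auto
      have le: "v + p * j \<le> K" and K_diff: "K - (v + p * j) = (p + a - v) + p * i"
        using that by (auto simp: K i algebra_simps)
      have "h (v + p * j) = B (v + p * j) * B (K - (v + p * j)) * alternating f g (v + p * j) (K - (v + p * j))"
        using le by (simp add: h_def)
      thus ?thesis
        using *[OF refl K_diff _ less, of v j] that by simp
    qed
    hence "(\<Sum>v\<in>{a<..<p}. h (v + p * j)) = B j * B i * ((\<Sum>v\<in>{a<..<p}. F v j * G (p + a - v) i) - (\<Sum>v\<in>{a<..<p}. G v j * F (p + a - v) i))"
      by (simp add: sum_distrib_left sum_subtractf right_diff_distrib)
    also have "(\<Sum>v\<in>{a<..<p}. G v j * F (p + a - v) i) = (\<Sum>v\<in>{a<..<p}. G (p + a - v) j * F v i)"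
      by (rule sum.reindex_bij_witness[of _ "\<lambda>v. p + a - v" "\<lambda>v. p + a - v"]) auto
    finally show ?thesis
      by (simp add: i alternating_def sum_subtractf)
  next
    case False
    hence "p * K' \<le> p * j"
      by (intro mult_le_mono2) auto
    hence "\<not> v + p * j \<le> K" if "v > a" for v
      using that K by linarith
    thus ?thesis
      using False by (auto simp: h_def)
  qed
  have split: "{..<p} = {..a} \<union> {a<..<p}"
    using a by auto
  have "pair_sum (alternating f g) K (Suc s) m = (\<Sum>j\<in>block s m. \<Sum>v<p. h (v + p * j))"
    unfolding pair_sum_def h_def by (rule sum_block_Suc)
  also have "\<dots> = (\<Sum>j\<in>block s m. \<Sum>v\<le>a. h (v + p * j)) + (\<Sum>j\<in>block s m. \<Sum>v\<in>{a<..<p}. h (v + p * j))"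
    unfolding split by (subst sum.union_disjoint) (auto simp: sum.distrib)
  also have "(\<Sum>j\<in>block s m. \<Sum>v\<le>a. h (v + p * j)) = pair_sum (\<lambda>x y. \<Sum>v\<le>a. alternating (F v) (G (a - v)) x y) K' s m"
    unfolding low pair_sum_def ..
  also have "\<dots> = (\<Sum>v\<le>a. pair_sum (alternating (F v) (G (a - v))) K' s m)"
    by (rule pair_sum_sum)
  also have "(\<Sum>j\<in>block s m. \<Sum>v\<in>{a<..<p}. h (v + p * j))
    = (if K' = 0 then 0 else \<Sum>v\<in>{a<..<p}. pair_sum (alternating (F v) (G (p + a - v))) (K' - 1) s m)"
  proof -
    have "(\<Sum>j\<in>block s m. \<Sum>v\<in>{a<..<p}. h (v + p * j)) = (if K' = 0 then 0
        else pair_sum (\<lambda>x y. \<Sum>v\<in>{a<..<p}. alternating (F v) (G (p + a - v)) x y) (K' - 1) s m)"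
      unfolding high pair_sum_def by simp
    thus ?thesis
      by (simp only: pair_sum_sum)
  qed
  finally show ?case
    using a by (auto simp: mult.assoc intro!: ideal_add ideal_sum IH)
qed

lemma weighted_congruence:
  assumes f: "lip 1 f"
    and w: "\<And>m s. B m * real p ^ s * (w (p ^ s * m) - w (p ^ (s + 1) * (m div p))) \<in> Zp"
    and w_0: "w 0 = 0"
  shows "(\<Sum>j\<le>K. w j * (B j * B (K - j) * (f j - f (K - j)))) \<in> ideal p"
proof -
  obtain r where r: "K < p ^ r"
    using power_gt_expt[of p K] p_gt_1 by auto
  define U where "U j = (if j \<le> K then B j * B (K - j) * (f j - f (K - j)) else 0)" for j
  \<comment> \<open>\<open>S s\<close> evaluates \<open>w\<close> at \<open>j\<close> rounded down
    to a multiple of \<open>p ^ s\<close>. Thus \<open>S 0\<close> is the sum in question, and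
    \<open>S r = 0\<close> because every \<open>j < p ^ r\<close> is rounded to 0.\<close>
  define S where "S s = (\<Sum>j<p ^ r. w (p ^ s * (j div p ^ s)) * U j)" for s
  have U_block: "(\<Sum>j\<in>block s m. U j) \<in> ideal (real p * (real p ^ s * B m))" for s m
  proof -
    have "(\<Sum>j\<in>block s m. U j) = pair_sum (alternating f (\<lambda>_. 1)) K s m"
      by (simp add: U_def pair_sum_def alternating_def cong: if_cong)
    thus ?thesis
      using pair_sum_alternating_lip_1[OF dwork_congruence f lip_const[of 1]] by simp
  qed
  have step: "S s - S (Suc s) \<in> ideal p" if "s < r" for s
  proof -
    have "S s - S (Suc s) = (\<Sum>j<p ^ r. (w (p ^ s * (j div p ^ s)) - w (p ^ (s + 1) * (j div p ^ s div p))) * U j)"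
      by (simp add: S_def left_diff_distrib right_diff_distrib sum_subtractf mult.commute div_mult2_eq[symmetric])
    also have "p ^ r = p ^ (r - s) * p ^ s"
      using that by (simp flip: power_add)
    also have "(\<Sum>j<p ^ (r - s) * p ^ s. (w (p ^ s * (j div p ^ s)) - w (p ^ (s + 1) * (j div p ^ s div p))) * U j)
      = (\<Sum>m<p ^ (r - s). \<Sum>j\<in>block s m. (w (p ^ s * (j div p ^ s)) - w (p ^ (s + 1) * (j div p ^ s div p))) * U j)"
      by (subst sum.nat_group[symmetric]) (simp add: block_def add.commute)
    also have "\<dots> = (\<Sum>m<p ^ (r - s). \<Sum>j\<in>block s m. (w (p ^ s * m) - w (p ^ (s + 1) * (m div p))) * U j)"
    proof (intro sum.cong refl)
      fix m j assume "j \<in> block s m"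
      hence "j div p ^ s = m"
        by (auto simp: block_def intro!: div_nat_eqI simp: algebra_simps)
      thus "(w (p ^ s * (j div p ^ s)) - w (p ^ (s + 1) * (j div p ^ s div p))) * U j
        = (w (p ^ s * m) - w (p ^ (s + 1) * (m div p))) * U j"
        by simp
    qed
    also have "\<dots> = (\<Sum>m<p ^ (r - s). (w (p ^ s * m) - w (p ^ (s + 1) * (m div p))) * (\<Sum>j\<in>block s m. U j))"
      by (simp add: sum_distrib_left)
    also have "\<dots> \<in> ideal p"
    proof (rule ideal_sum)
      fix m
      obtain c where c: "c \<in> Zp" "(\<Sum>j\<in>block s m. U j) = real p * (real p ^ s * B m) * c"
        by (rule idealE[OF U_block])
      \<comment> \<open>The block sum supplies \<open>p * p ^ s * B m\<close>; the hypothesis on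
        \<open>w\<close> spends \<open>p ^ s * B m\<close> on the difference of weights, and one
        factor \<open>p\<close> survives.\<close>
      have "(w (p ^ s * m) - w (p ^ (s + 1) * (m div p))) * (\<Sum>j\<in>block s m. U j)
        = p * (B m * real p ^ s * (w (p ^ s * m) - w (p ^ (s + 1) * (m div p))) * c)"
        by (simp add: c(2))
      also have "\<dots> \<in> ideal p"
        by (intro idealI Zp_mult w c)
      finally show "(w (p ^ s * m) - w (p ^ (s + 1) * (m div p))) * (\<Sum>j\<in>block s m. U j) \<in> ideal p" .
    qed
    finally show ?thesis .
  qed
  have "S 0 - S s \<in> ideal p" if "s \<le> r" for s
    using that
  proof (induction s)
    case (Suc s)
    thus ?case
      using ideal_add[of "S 0 - S s" p "S s - S (Suc s)"] step[of s] by simp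
  qed simp
  moreover have "S r = 0"
    by (auto simp: S_def w_0)
  ultimately have "S 0 \<in> ideal p"
    by (metis diff_zero le_refl)
  also have "S 0 = (\<Sum>j\<le>K. w j * U j)"
    unfolding S_def using r by (intro sum.mono_neutral_cong_right) (auto simp: U_def)
  finally show ?thesis
    by (simp add: U_def)
qed

end

subsection \<open>Products of integers prime to N and p-adic variation of the coefficients\<close>

text \<open>A factorial restricted to integers prime to \<open>c\<close>: \<open>c = 1\<close> gives
  \<open>fact X\<close>, and \<open>c = p\<close> gives, up to sign, values of Morita's
  \<open>p\<close>-adic gamma function.\<close>

definition cprod :: "nat \<Rightarrow> nat \<Rightarrow> nat" where
  "cprod c X = (\<Prod>i=1..X. if coprime i c then i else 1)"

definition ccard :: "nat \<Rightarrow> nat \<Rightarrow> nat" where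
  "ccard c X = (\<Sum>i=1..X. if coprime i c then 1 else 0)"

lemma cprod_0 [simp]: "cprod c 0 = 1"
  by (simp add: cprod_def)

lemma ccard_0 [simp]: "ccard c 0 = 0"
  by (simp add: ccard_def)

lemma cprod_Suc: "cprod c (Suc X) = cprod c X * (if coprime (Suc X) c then Suc X else 1)"
  by (simp add: cprod_def)

lemma ccard_Suc: "ccard c (Suc X) = ccard c X + (if coprime (Suc X) c then 1 else 0)"
  by (simp add: ccard_def)

lemma cprod_pos: "cprod c X > 0"
  by (auto simp: cprod_def intro!: prod_pos)

lemma cprod_1: "cprod (Suc 0) X = fact X"
  by (induction X) (simp_all add: cprod_Suc)

lemma ccard_1: "ccard (Suc 0) X = X"
  by (induction X) (simp_all add: ccard_Suc)

lemma coprime_cprod: "coprime (cprod c X) c"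
  unfolding cprod_def by (intro prod_coprime_left) auto

lemma cprod_add: "cprod c (X + Y) = cprod c X * (\<Prod>i=1..Y. if coprime (X + i) c then X + i else 1)"
  by (induction Y) (simp_all add: cprod_Suc)

lemma ccard_add: "ccard c (X + Y) = ccard c X + (\<Sum>i=1..Y. if coprime (X + i) c then 1 else 0)"
  by (induction Y) (simp_all add: ccard_Suc)

lemma coprime_mult_add_nat: "coprime (N * m + i) N \<longleftrightarrow> coprime i (N :: nat)"
  by (metis coprime_iff_gcd_eq_1 gcd.commute gcd_add_mult mult.commute add.commute)

lemma cprod_mult_add:
  "cprod N (N * m + y) = cprod N (N * m) * (\<Prod>i=1..y. if coprime i N then N * m + i else 1)"
  by (simp add: cprod_add coprime_mult_add_nat cong: if_cong)

lemma ccard_self: "ccard N N = totient N"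
proof -
  have "ccard N N = (\<Sum>i\<in>totatives N. 1)"
    unfolding ccard_def
    by (rule sum.mono_neutral_cong_right) (auto simp: totatives_def)
  thus ?thesis
    by (simp add: totient_def)
qed

lemma ccard_mult_add: "ccard N (N * m + y) = totient N * m + ccard N y"
proof -
  have *: "ccard N (N * m + y) = ccard N (N * m) + ccard N y" for m y
    unfolding ccard_add coprime_mult_add_nat by (simp add: ccard_def[of N y])
  have "ccard N (N * m) = totient N * m"
  proof (induction m)
    case (Suc m)
    thus ?case
      using *[of m N] by (simp add: ccard_self algebra_simps)
  qed simp
  with * show ?thesis
    by simp
qed

lemma ccard_pos: "y \<ge> 1 \<Longrightarrow> ccard c y \<ge> 1"
proof (induction y)
  case (Suc y)
  thus ?case
    by (cases y) (simp_all add: ccard_Suc)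
qed simp

text \<open>The part of \<open>C_coeff\<close> that remains once \<open>N ^ totient N\<close> has
  cleared the denominators of the parameters \<open>r / N\<close>.\<close>

definition P_coeff :: "nat \<Rightarrow> nat" where
  "P_coeff N = (\<Prod>q\<in>prime_factors N. q ^ (totient N div (q - 1)))"

lemma C_coeff_eq: "C_coeff N = N ^ totient N * P_coeff N"
  by (simp add: C_coeff_def P_coeff_def)

lemma prod_totatives:
  "(\<Prod>i=1..N. if coprime i N then f i else 1) = (\<Prod>r\<in>totatives N. f r)"
  by (rule prod.mono_neutral_cong_right) (auto simp: totatives_def)

text \<open>Each \<open>N ^ m * pochhammer (r / N) m\<close> is the product of
  \<open>r + N * i\<close> over \<open>i < m\<close>; as \<open>r\<close> runs through the
  totatives, these factors are exactly the integers up to \<open>N * m\<close> prime to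
  \<open>N\<close>.\<close>

lemma B_coeff_eq:
  assumes "N \<ge> 1"
  shows "B_coeff N m * fact m ^ totient N = real (P_coeff N ^ m * cprod N (N * m))"
proof (induction m)
  case 0
  thus ?case by (simp add: B_coeff_def)
next
  case (Suc m)
  have N: "real N \<noteq> 0"
    using assms by simp
  have "(\<Prod>r\<in>totatives N. pochhammer (real r / real N) (Suc m) / fact (Suc m))
    = (\<Prod>r\<in>totatives N. (pochhammer (real r / real N) m / fact m) * ((real r / real N + real m) / real (Suc m)))"
    by (intro prod.cong refl) (simp add: pochhammer_Suc)
  also have "\<dots> = (\<Prod>r\<in>totatives N. pochhammer (real r / real N) m / fact m)
      * (\<Prod>r\<in>totatives N. (real r / real N + real m) / real (Suc m))"
    by (rule prod.distrib)
  finally have "B_coeff N (Suc m) = B_coeff N m * real (C_coeff N) *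
      (\<Prod>r\<in>totatives N. (real r / real N + real m) / real (Suc m))"
    by (simp add: B_coeff_def del: of_nat_Suc)
  also have "(\<Prod>r\<in>totatives N. (real r / real N + real m) / real (Suc m))
    = (\<Prod>r\<in>totatives N. real (N * m + r) / (real N * real (Suc m)))"
    using N by (intro prod.cong refl) (simp add: field_simps)
  also have "\<dots> = (\<Prod>r\<in>totatives N. real (N * m + r)) / (real N ^ totient N * real (Suc m) ^ totient N)"
    by (simp add: prod_dividef totient_def power_mult_distrib del: of_nat_Suc)
  finally have "B_coeff N (Suc m) * fact (Suc m) ^ totient N = (B_coeff N m * fact m ^ totient N) *
      (real (P_coeff N) * (\<Prod>r\<in>totatives N. real (N * m + r)))"
    using N by (simp add: C_coeff_eq power_mult_distrib del: of_nat_Suc)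
  also have "(\<Prod>r\<in>totatives N. real (N * m + r)) = real (\<Prod>i=1..N. if coprime i N then N * m + i else 1)"
    by (simp only: prod_totatives of_nat_prod)
  also have "(B_coeff N m * fact m ^ totient N) * (real (P_coeff N) * \<dots>)
     = real (P_coeff N ^ Suc m * cprod N (N * m + N))"
    unfolding Suc.IH cprod_mult_add by simp
  finally show ?case
    by (simp add: add.commute)
qed

section \<open>Restricted factorials modulo powers of p, and the ratios of coefficients\<close>

context prime_place
begin

lemma coprime_p_iff: "coprime n p \<longleftrightarrow> \<not> p dvd n"
  using prime_p by (metis coprime_commute coprime_absorb_right not_prime_unit prime_imp_coprime)

text \<open>The factors divisible by \<open>p\<close> are \<open>p * i\<close> with
  \<open>i \<le> X div p\<close>, and since \<open>p\<close> does not divide \<open>c\<close>, such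
  a factor is prime to \<open>c\<close> iff \<open>i\<close> is.\<close>

lemma cprod_split:
  assumes "\<not> p dvd c"
  shows "cprod c X = cprod (c * p) X * p ^ ccard c (X div p) * cprod c (X div p)"
proof (induction X)
  case (Suc X)
  show ?case
  proof (cases "p dvd Suc X")
    case True
    then obtain k where k: "Suc X = p * k"
      by (elim dvdE)
    have div: "Suc X div p = Suc (X div p)"
      using True by (simp add: div_Suc dvd_eq_mod_eq_0)
    hence k': "k = Suc (X div p)"
      using k p_pos by simp
    have 1: "\<not> coprime (Suc X) (c * p)"
      using True coprime_p_iff by auto
    have 2: "coprime (Suc X) c \<longleftrightarrow> coprime (Suc (X div p)) c"
      unfolding k coprime_mult_left_iff using assms k' coprime_p_iff[of c]
      by (simp add: coprime_commute)
    have 3: "Suc X = p * Suc (X div p)"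
      using k k' by simp
    have "cprod c (Suc X) = cprod c X * (if coprime (Suc (X div p)) c then p * Suc (X div p) else 1)"
      unfolding cprod_Suc 2 3[symmetric] ..
    also have "\<dots> = cprod (c * p) X * p ^ ccard c (X div p) * cprod c (X div p) *
        (if coprime (Suc (X div p)) c then p * Suc (X div p) else 1)"
      using Suc.IH by simp
    also have "\<dots> = cprod (c * p) (Suc X) * p ^ ccard c (Suc X div p) * cprod c (Suc X div p)"
    proof -
      have "cprod (c * p) (Suc X) = cprod (c * p) X"
        by (simp only: cprod_Suc 1 if_False mult_1_right)
      thus ?thesis
        unfolding div cprod_Suc[of c "X div p"] ccard_Suc
        by (simp add: mult_ac del: mult_Suc_right)
    qed
    finally show ?thesis .
  next
    case False
    hence div: "Suc X div p = X div p"
      by (auto simp: div_Suc dvd_eq_mod_eq_0)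
    have "coprime (Suc X) (c * p) \<longleftrightarrow> coprime (Suc X) c"
      using False coprime_p_iff by simp
    thus ?thesis
      using Suc.IH unfolding div cprod_Suc by (auto simp: mult_ac)
  qed
qed simp

text \<open>The counting analogue of \<open>cprod_split\<close>. Only the primes dividing
  \<open>d\<close> matter, so \<open>d\<close> may be an \<open>N\<close> containing a higher power
  of \<open>p\<close>.\<close>

lemma ccard_split:
  assumes "\<not> p dvd c" and d: "\<And>i. coprime i d \<longleftrightarrow> coprime i (c * p)"
  shows "ccard c X = ccard d X + ccard c (X div p)"
proof (induction X)
  case (Suc X)
  show ?case
  proof (cases "p dvd Suc X")
    case True
    then obtain k where k: "Suc X = p * k"
      by (elim dvdE)
    have div: "Suc X div p = Suc (X div p)"
      using True by (simp add: div_Suc dvd_eq_mod_eq_0)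
    hence k': "k = Suc (X div p)"
      using k p_pos by simp
    have "\<not> coprime (Suc X) (c * p)"
      using True coprime_p_iff by auto
    moreover have "coprime (Suc X) c \<longleftrightarrow> coprime (Suc (X div p)) c"
      unfolding k coprime_mult_left_iff using assms k' coprime_p_iff[of c]
      by (simp add: coprime_commute)
    ultimately show ?thesis
      using Suc.IH unfolding div ccard_Suc d by simp
  next
    case False
    hence div: "Suc X div p = X div p"
      by (auto simp: div_Suc dvd_eq_mod_eq_0)
    have "coprime (Suc X) (c * p) \<longleftrightarrow> coprime (Suc X) c"
      using False coprime_p_iff by simp
    thus ?thesis
      using Suc.IH unfolding div ccard_Suc d by simp
  qed
qed simp

text \<open>
  The extra factors cancel between numerator and denominator of \<open>B_coeff\<close>, so their value
  (a Wilson-type sign) is irrelevant.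
\<close>

lemma cprod_block:
  assumes N': "\<not> p dvd N'" "N' \<ge> 1" and t: "t \<ge> 1"
    and c: "\<And>i. coprime i c \<longleftrightarrow> coprime i (N' * p)"
  shows "[cprod c (M + k * (N' * p ^ t)) = cprod c M * \<Prod>(totatives (p ^ t)) ^ (totient N' * k)] (mod p ^ t)"
proof -
  define q where "q = p ^ t"
  define n where "n = N' * q"
  \<comment> \<open>Actual residues, rather than congruence classes, make the factors exactly
    periodic with period \<open>n\<close>; positivity then allows cancellation in the
    naturals.\<close>
  define g where "g i = (if coprime i c then i mod q else 1)" for i
  have q: "q > 1"
    using one_less_power[OF p_gt_1, of t] t by (simp add: q_def)
  have p_q: "p dvd q"
    using t by (simp add: q_def)
  have coprime_q: "coprime i q \<longleftrightarrow> coprime i p" for i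
    using t by (simp add: q_def)
  have c_n: "coprime i c \<longleftrightarrow> coprime i n" for i
    by (simp add: c n_def coprime_q)
  have g_pos: "g i > 0" for i
  proof (cases "coprime i c")
    case True
    hence "\<not> p dvd i"
      using c coprime_p_iff by auto
    hence "\<not> q dvd i"
      using p_q by (meson dvd_trans)
    thus ?thesis
      by (simp add: g_def mod_greater_zero_iff_not_dvd)
  qed (simp add: g_def)
  have g_period: "g (i + n) = g i" for i
  proof -
    have "coprime (i + n) n \<longleftrightarrow> coprime i n"
      by (metis coprime_mult_add_nat add.commute mult.right_neutral)
    moreover have "(i + n) mod q = i mod q"
      by (simp add: n_def)
    ultimately show ?thesis
      by (simp add: g_def c_n)
  qed
  \<comment> \<open>Sliding the window by one step drops one factor and adds an equal one.\<close>
  have shift: "(\<Prod>i=1..n. g (X + i)) = (\<Prod>i=1..n. g i)" for X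
  proof (induction X)
    case (Suc X)
    have "(\<Prod>i=1..n. g (Suc X + i)) * g (Suc X) = (\<Prod>i=0..n. g (Suc X + i))"
      by (simp add: prod.atLeast_Suc_atMost mult.commute)
    also have "\<dots> = (\<Prod>i=1..Suc n. g (X + i))"
      by (rule prod.reindex_bij_witness[of _ "\<lambda>i. i - 1" Suc]) auto
    also have "\<dots> = (\<Prod>i=1..n. g (X + i)) * g (Suc X)"
      using g_period[of "Suc X"] by simp
    finally show ?case
      using g_pos[of "Suc X"] Suc by simp
  qed simp
  \<comment> \<open>By the Chinese remainder theorem every unit residue modulo \<open>q\<close>
    occurs \<open>totient N'\<close> times in one period.\<close>
  have period: "(\<Prod>i=1..n. g i) = \<Prod>(totatives q) ^ totient N'"
  proof (cases "N' = 1")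
    case True
    have "(\<Prod>i=1..n. g i) = (\<Prod>i\<in>totatives n. i mod q)"
      unfolding g_def c_n by (rule prod_totatives)
    also have "\<dots> = \<Prod>(totatives q)"
      using True q by (intro prod.cong) (auto simp: n_def totatives_less)
    finally show ?thesis
      using True by simp
  next
    case False
    have "coprime N' q"
      using N' coprime_p_iff coprime_q by blast
    hence bij: "bij_betw (\<lambda>x. (x mod N', x mod q)) (totatives n) (totatives N' \<times> totatives q)"
      unfolding n_def using False N' q by (intro bij_betw_totatives) auto
    have "(\<Prod>i=1..n. g i) = (\<Prod>i\<in>totatives n. i mod q)"
      unfolding g_def c_n by (rule prod_totatives)
    also have "\<dots> = (\<Prod>i\<in>totatives n. snd (i mod N', i mod q))"
      by simp
    also have "\<dots> = (\<Prod>(x,y)\<in>totatives N' \<times> totatives q. y)"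
      by (subst prod.reindex_bij_betw[OF bij]) (simp add: case_prod_unfold)
    also have "\<dots> = (\<Prod>x\<in>totatives N'. \<Prod>(totatives q))"
      by (rule prod.cartesian_product[symmetric])
    finally show ?thesis
      by (simp add: totient_def)
  qed
  have "[cprod c (M + k * n) = cprod c M * \<Prod>(totatives q) ^ (totient N' * k)] (mod q)"
  proof (induction k)
    case (Suc k)
    define X where "X = M + k * n"
    have "[(\<Prod>i=1..n. if coprime (X + i) c then X + i else 1) = (\<Prod>i=1..n. g (X + i))] (mod q)"
      by (intro cong_prod) (auto simp: g_def cong_def)
    hence "[cprod c (X + n) = cprod c X * \<Prod>(totatives q) ^ totient N'] (mod q)"
      unfolding cprod_add shift period by (rule cong_scalar_left)
    also have "[cprod c X * \<Prod>(totatives q) ^ totient N'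
      = (cprod c M * \<Prod>(totatives q) ^ (totient N' * k)) * \<Prod>(totatives q) ^ totient N'] (mod q)"
      using Suc.IH unfolding X_def by (rule cong_scalar_right)
    finally show ?case
      by (simp add: X_def power_add algebra_simps)
  qed simp
  thus ?thesis
    by (simp add: n_def q_def)
qed

text \<open>Numerator and denominator pick up the same factor \<open>w\<close>, so
  cross-multiplication eliminates it; the denominators are units at \<open>p\<close>, so the
  congruence passes to the quotient.\<close>

lemma lip_1_ratio:
  assumes b: "\<And>m. \<not> p dvd b m"
    and w: "\<And>m s. \<exists>w. [a (m + p ^ s) = a m * w] (mod p ^ (s + 1)) \<and> [b (m + p ^ s) = b m * w] (mod p ^ (s + 1))"
  shows "lip 1 (\<lambda>m. real (a m) / real (b m))"
  unfolding lip_def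
proof (intro conjI allI)
  fix m s
  obtain w where w: "[a (m + p ^ s) = a m * w] (mod p ^ (s + 1))" "[b (m + p ^ s) = b m * w] (mod p ^ (s + 1))"
    using assms(2) by blast
  have "[a (m + p ^ s) * b m = a m * w * b m] (mod p ^ (s + 1))"
    using w(1) by (rule cong_scalar_right)
  also have "a m * w * b m = a m * (b m * w)"
    by simp
  also have "[a m * (b m * w) = a m * b (m + p ^ s)] (mod p ^ (s + 1))"
    using w(2) by (intro cong_scalar_left) (rule cong_sym)
  finally have "real (a (m + p ^ s) * b m) - real (a m * b (m + p ^ s)) \<in> ideal (real p ^ (s + 1))"
    by (rule cong_ideal)
  moreover have "1 / real (b m * b (m + p ^ s)) \<in> Zp"
    using b prime_p by (intro Zp_inverse_nat) (simp add: prime_dvd_mult_iff)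
  ultimately have "(real (a (m + p ^ s) * b m) - real (a m * b (m + p ^ s))) * (1 / real (b m * b (m + p ^ s)))
      \<in> ideal (real p ^ (s + 1))"
    by (intro ideal_scale')
  moreover have "b i > 0" for i
    using b[of i] by (intro Nat.gr0I) auto
  hence "real (a (m + p ^ s)) / real (b (m + p ^ s)) - real (a m) / real (b m)
    = (real (a (m + p ^ s) * b m) - real (a m * b (m + p ^ s))) * (1 / real (b m * b (m + p ^ s)))"
    by (simp add: field_simps)
  ultimately show "real (a (m + p ^ s)) / real (b (m + p ^ s)) - real (a m) / real (b m) \<in> ideal (real p ^ (s + 1))"
    by simp
next
  show "real (a m) / real (b m) \<in> Zp" for m
    using b by (intro Zp_divide_nat) auto
qed

text \<open>Raising \<open>m\<close> by \<open>p ^ s\<close> adds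
  \<open>totient (p ^ (s + 1))\<close> to the exponent, so this is Euler's theorem.\<close>

lemma lip_1_power:
  assumes "\<not> p dvd n"
  shows "lip 1 (\<lambda>m. real n ^ (v + (p - 1) * m))"
  unfolding lip_def
proof (intro conjI allI)
  fix m s
  have "coprime n (p ^ (s + 1))"
    using assms coprime_p_iff by simp
  moreover have "totient (p ^ (s + 1)) = p ^ s * (p - 1)"
    using totient_prime_power_Suc[OF prime_p, of s] by simp
  ultimately have "[n ^ (p ^ s * (p - 1)) = 1] (mod p ^ (s + 1))"
    by (metis euler_theorem)
  hence "[n ^ (v + (p - 1) * m) * n ^ (p ^ s * (p - 1)) = n ^ (v + (p - 1) * m) * 1] (mod p ^ (s + 1))"
    by (rule cong_scalar_left)
  from cong_ideal[OF this]
  show "real n ^ (v + (p - 1) * (m + p ^ s)) - real n ^ (v + (p - 1) * m) \<in> ideal (real p ^ (s + 1))"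
    by (simp add: algebra_simps flip: power_add)
qed auto

text \<open>Isolates the power of \<open>p\<close>. For \<open>p dvd N\<close>, the relation
  \<open>f * (p - 1) = totient N\<close> balances it against the powers of \<open>p\<close> that
  \<open>fact (v + p * m)\<close> brings into the ratio.\<close>

lemma P_coeff_decompose:
  obtains f P where "P_coeff N = p ^ f * P" "\<not> p dvd P"
    "\<not> p dvd N \<longrightarrow> f = 0" "p dvd N \<and> N > 0 \<longrightarrow> f * (p - 1) = totient N"
proof
  define S where "S = prime_factors N - {p}"
  show "P_coeff N = p ^ (if p \<in> prime_factors N then totient N div (p - 1) else 0)
      * (\<Prod>q\<in>S. q ^ (totient N div (q - 1)))"
    by (simp add: P_coeff_def S_def prod.remove)
  have "\<not> p dvd q ^ e" if "q \<in> S" for q e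
    using that prime_p prime_dvd_power primes_dvd_imp_eq
    unfolding S_def by (metis DiffD1 DiffD2 in_prime_factors_imp_prime singletonI)
  thus "\<not> p dvd (\<Prod>q\<in>S. q ^ (totient N div (q - 1)))"
    using prime_p by (auto simp: prime_dvd_prod_iff S_def)
  show "\<not> p dvd N \<longrightarrow> (if p \<in> prime_factors N then totient N div (p - 1) else 0) = 0"
    by auto
  show "p dvd N \<and> N > 0 \<longrightarrow>
      (if p \<in> prime_factors N then totient N div (p - 1) else 0) * (p - 1) = totient N"
    using prime_p diff_one_dvd_totient[of p N] by (auto simp: in_prime_factors_iff)
qed

lemma fact_split: "fact (v + p * m) = cprod p (v + p * m) * p ^ m * fact m" if "v < p"
proof -
  have "cprod (Suc 0) (v + p * m) = cprod p (v + p * m) * p ^ m * cprod (Suc 0) m"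
    using that cprod_split[of "Suc 0" "v + p * m"] p_gt_1 by (simp add: ccard_1)
  thus ?thesis
    by (simp only: cprod_1)
qed

lemma not_dvd_cprod: "p dvd c \<Longrightarrow> \<not> p dvd cprod c X"
  using coprime_cprod[of c X] coprime_p_iff coprime_divisors[of "cprod c X" "cprod c X" p c] by auto

lemma not_dvd_power: "\<not> p dvd n \<Longrightarrow> \<not> p dvd n ^ k"
  using prime_p prime_dvd_power by blast

lemma cprod_p_shift:
  "[cprod p (v + p * (m + p ^ s)) = cprod p (v + p * m) * \<Prod>(totatives (p ^ (s + 1)))] (mod p ^ (s + 1))"
  using cprod_block[of 1 "s + 1" p "v + p * m" 1] p_gt_1 by (simp add: algebra_simps)

text \<open>Divide the closed forms of \<open>B_coeff_eq\<close> at \<open>v + p * m\<close> and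
  \<open>m\<close>, and remove the multiples of \<open>p\<close> from all factorials. What remains
  are powers of the \<open>p\<close>-free part \<open>P\<close>, quotients of \<open>p\<close>-free
  products, and explicit multiples of \<open>p\<close>.\<close>

lemma B_coeff_ratio:
  assumes N: "N \<ge> 1" and v: "v < p"
  shows "\<exists>R. lip 1 R \<and> (\<forall>m. B_coeff N (v + p * m) = R m * B_coeff N m)"
proof -
  obtain f P where P: "P_coeff N = p ^ f * P" "\<not> p dvd P"
    "\<not> p dvd N \<longrightarrow> f = 0" "p dvd N \<and> N > 0 \<longrightarrow> f * (p - 1) = totient N"
    by (rule P_coeff_decompose[of N])
  define \<phi> where "\<phi> = totient N"
  have p: "real p \<noteq> 0"
    using p_pos by simp
  have exponent: "v + p * m = (v + (p - 1) * m) + m" for m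
    using p_pos by (cases p) simp_all
  have B: "B_coeff N m * fact m ^ \<phi> = real P ^ m * real p ^ (f * m) * real (cprod N (N * m))" for m
    using B_coeff_eq[OF N, of m] by (simp add: P \<phi>_def power_mult_distrib power_mult)
  have B': "B_coeff N (v + p * m) * real (cprod p (v + p * m)) ^ \<phi> * real p ^ (\<phi> * m) * fact m ^ \<phi>
    = real P ^ (v + (p - 1) * m) * real P ^ m * real p ^ (f * (v + (p - 1) * m) + f * m) *
      real (cprod N (N * (v + p * m)))" for m
  proof -
    have fact: "(fact (v + p * m) :: real) = real (cprod p (v + p * m)) * real p ^ m * fact m"
      using arg_cong[OF fact_split[OF v, of m], of real] by simp
    have "B_coeff N (v + p * m) * fact (v + p * m) ^ \<phi> = real P ^ ((v + (p - 1) * m) + m) *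
        real p ^ (f * ((v + (p - 1) * m) + m)) * real (cprod N (N * (v + p * m)))"
      using B[of "v + p * m"] by (simp only: exponent[symmetric])
    thus ?thesis
      unfolding fact
      by (simp only: power_mult_distrib power_add power_mult[symmetric] distrib_left mult_ac)
  qed
  have cp: "cprod p X > 0" for X
    by (rule cprod_pos)
  show ?thesis
  proof (cases "p dvd N")
    case False
    \<comment> \<open>The multiples of \<open>p\<close> prime to \<open>N\<close> in the interval
      from \<open>N * p * m\<close> (excluded) to \<open>N * (v + p * m)\<close>. They have no
      partner in \<open>B_coeff N m\<close>; their visible factor \<open>p\<close> makes them
      \<open>lip 1\<close>.\<close>
    define E where "E m = (\<Prod>i=1..N * v div p. if coprime i N then real (p * (N * m + i)) else 1)" for m
    define U where "U m = real (cprod (N * p) (N * (v + p * m))) / real (cprod p (v + p * m) ^ \<phi>)" for m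
    define R where "R m = real P ^ (v + (p - 1) * m) * (U m * E m)" for m
    have E: "lip 1 E"
      unfolding E_def
    proof (intro lip_prod)
      fix i
      show "lip 1 (\<lambda>m. if coprime i N then real (p * (N * m + i)) else 1)"
      proof (cases "coprime i N")
        case True
        have "real (p * (N * (m + p ^ s) + i)) - real (p * (N * m + i)) = real p ^ (s + 1) * real N" for m s
          by (simp add: algebra_simps)
        hence "real (p * (N * (m + p ^ s) + i)) - real (p * (N * m + i)) \<in> ideal (real p ^ (s + 1))" for m s
          by (simp only: idealI Zp_of_nat)
        thus ?thesis
          using True by (simp add: lip_def del: of_nat_mult of_nat_add)
      qed (simp add: lip_const)
    qed
    have U: "lip 1 U"
      unfolding U_def
    proof (rule lip_1_ratio)
      show "\<not> p dvd cprod p (v + p * m) ^ \<phi>" for m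
        by (intro not_dvd_power not_dvd_cprod) simp
      fix m s
      define W where "W = \<Prod>(totatives (p ^ (s + 1)))"
      have "N * (v + p * (m + p ^ s)) = N * (v + p * m) + 1 * (N * p ^ (s + 1))"
        by (simp add: algebra_simps)
      hence "[cprod (N * p) (N * (v + p * (m + p ^ s))) = cprod (N * p) (N * (v + p * m)) * W ^ (\<phi> * 1)] (mod p ^ (s + 1))"
        using cprod_block[where N' = N and t = "s + 1" and c = "N * p" and M = "N * (v + p * m)" and k = 1,
            OF False N le_add2 refl]
        by (simp only: W_def \<phi>_def)
      moreover have "[cprod p (v + p * (m + p ^ s)) ^ \<phi> = (cprod p (v + p * m) * W) ^ \<phi>] (mod p ^ (s + 1))"
        unfolding W_def by (intro cong_pow cprod_p_shift)
      ultimately show "\<exists>w. [cprod (N * p) (N * (v + p * (m + p ^ s))) = cprod (N * p) (N * (v + p * m)) * w] (mod p ^ (s + 1)) \<and>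
          [cprod p (v + p * (m + p ^ s)) ^ \<phi> = cprod p (v + p * m) ^ \<phi> * w] (mod p ^ (s + 1))"
        by (intro exI[of _ "W ^ \<phi>"]) (simp add: power_mult_distrib)
    qed
    have "lip 1 R"
      unfolding R_def by (intro lip_mult lip_1_power P(2) U E)
    moreover have "B_coeff N (v + p * m) = R m * B_coeff N m" for m
    proof -
      have X: "N * (v + p * m) div p = N * m + N * v div p"
      proof -
        have "N * (v + p * m) = N * v + p * (N * m)"
          by (simp add: algebra_simps)
        thus ?thesis
          using p_pos by simp
      qed
      have E_eq: "E m = real p ^ ccard N (N * v div p) * real (\<Prod>i=1..N * v div p. if coprime i N then N * m + i else 1)"
      proof -
        have "E m = (\<Prod>i=1..N * v div p. (if coprime i N then real p else 1) * (if coprime i N then real (N * m + i) else 1))"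
          unfolding E_def by (intro prod.cong) auto
        also have "\<dots> = (\<Prod>i=1..N * v div p. if coprime i N then real p else 1) *
            (\<Prod>i=1..N * v div p. if coprime i N then real (N * m + i) else 1)"
          by (rule prod.distrib)
        also have "(\<Prod>i=1..n. if coprime i N then real p else 1) = real p ^ ccard N n" for n
          by (induction n) (simp_all add: ccard_Suc)
        finally show ?thesis
          by (simp add: of_nat_prod if_distrib cong: if_cong)
      qed
      have "cprod N (N * (v + p * m)) = cprod (N * p) (N * (v + p * m)) *
          p ^ (\<phi> * m + ccard N (N * v div p)) * (cprod N (N * m) *
          (\<Prod>i=1..N * v div p. if coprime i N then N * m + i else 1))"
        using cprod_split[OF False, of "N * (v + p * m)"]
        by (simp only: X ccard_mult_add cprod_mult_add \<phi>_def)
      hence "real (cprod N (N * (v + p * m))) = real (cprod (N * p) (N * (v + p * m))) *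
          real p ^ (\<phi> * m) * real (cprod N (N * m)) * E m"
        by (simp only: E_eq of_nat_mult of_nat_power power_add mult_ac)
      also have "real (cprod (N * p) (N * (v + p * m))) = U m * real (cprod p (v + p * m)) ^ \<phi>"
        using cp[of "v + p * m"] by (simp add: U_def)
      finally have "B_coeff N (v + p * m) * (real (cprod p (v + p * m)) ^ \<phi> * real p ^ (\<phi> * m) * fact m ^ \<phi>)
        = R m * (real P ^ m * real (cprod N (N * m))) * (real (cprod p (v + p * m)) ^ \<phi> * real p ^ (\<phi> * m))"
        using B'[of m] P(3)[rule_format, OF False] by (simp add: R_def mult_ac)
      also have "real P ^ m * real (cprod N (N * m)) = B_coeff N m * fact m ^ \<phi>"
        using B[of m] P(3)[rule_format, OF False] by simp
      finally show ?thesis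
        using cp[of "v + p * m"] p by (simp add: mult_ac)
    qed
    ultimately show ?thesis
      by blast
  next
    case True
    \<comment> \<open>Here \<open>cprod N\<close> contains no multiple of \<open>p\<close>, so
      nothing is split off and \<open>cprod N (N * m)\<close> stays in the denominator as a
      unit.\<close>
    define b where "b m = cprod N (N * m) * cprod p (v + p * m) ^ \<phi>" for m
    define U where "U m = real (cprod N (N * (v + p * m))) / real (b m)" for m
    define R where "R m = real P ^ (v + (p - 1) * m) * (real p ^ (f * v) * U m)" for m
    have f: "f * (p - 1) = \<phi>"
      using P(4) True N by (simp add: \<phi>_def)
    obtain e N' where N': "N = p ^ e * N'" "\<not> p dvd N'"
      using prime_p N by (metis multiplicity_decompose' not_one_le_zero not_prime_unit)
    have "e \<noteq> 0"
      using N' True by (intro notI) simp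
    then obtain e' where e': "e = Suc e'"
      using not0_implies_Suc by blast
    have N'_pos: "N' \<ge> 1"
      using N N' by (cases N') auto
    have "totient N = totient (p ^ e) * totient N'"
      unfolding N' using N' coprime_p_iff[of N']
      by (intro totient_mult_coprime) (simp add: coprime_commute)
    hence \<phi>: "\<phi> = p ^ e' * (p - 1) * totient N'"
      using totient_prime_power_Suc[OF prime_p, of e'] by (simp add: \<phi>_def e')
    have coprime_N: "coprime i N \<longleftrightarrow> coprime i (N' * p)" for i
      using \<open>e \<noteq> 0\<close> by (auto simp: N')
    have U: "lip 1 U"
      unfolding U_def
    proof (rule lip_1_ratio)
      show "\<not> p dvd b m" for m
        using True prime_p unfolding b_def
        by (simp add: prime_dvd_mult_iff not_dvd_power not_dvd_cprod)
      fix m s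
      define W where "W = \<Prod>(totatives (p ^ (s + 1)))"
      define w where "w = W ^ (totient N' * p ^ e)"
      have "N * (v + p * (m + p ^ s)) = N * (v + p * m) + p ^ e * (N' * p ^ (s + 1))"
        by (simp add: N' algebra_simps)
      hence 1: "[cprod N (N * (v + p * (m + p ^ s))) = cprod N (N * (v + p * m)) * w] (mod p ^ (s + 1))"
        using cprod_block[OF N'(2) N'_pos _ coprime_N, of "s + 1" "N * (v + p * m)" "p ^ e"]
        by (simp add: W_def w_def)
      have "N * (m + p ^ s) = N * m + p ^ e' * (N' * p ^ (s + 1))"
        by (simp add: N' e' algebra_simps)
      hence "[cprod N (N * (m + p ^ s)) = cprod N (N * m) * W ^ (totient N' * p ^ e')] (mod p ^ (s + 1))"
        using cprod_block[OF N'(2) N'_pos _ coprime_N, of "s + 1" "N * m" "p ^ e'"]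
        by (simp add: W_def)
      moreover have "[cprod p (v + p * (m + p ^ s)) ^ \<phi> = (cprod p (v + p * m) * W) ^ \<phi>] (mod p ^ (s + 1))"
        unfolding W_def by (intro cong_pow cprod_p_shift)
      ultimately have "[b (m + p ^ s) = (cprod N (N * m) * W ^ (totient N' * p ^ e')) *
          (cprod p (v + p * m) * W) ^ \<phi>] (mod p ^ (s + 1))"
        unfolding b_def by (rule cong_mult)
      also have "(cprod N (N * m) * W ^ (totient N' * p ^ e')) * (cprod p (v + p * m) * W) ^ \<phi>
        = b m * W ^ (totient N' * p ^ e' + \<phi>)"
        by (simp add: b_def power_mult_distrib power_add)
      \<comment> \<open>The exponents of \<open>W\<close> in numerator and denominator agree because
        \<open>totient N = p ^ e' * (p - 1) * totient N'\<close>.\<close>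
      also have "totient N' * p ^ e' + \<phi> = totient N' * p ^ e"
      proof -
        obtain p' where "p = Suc p'"
          using p_pos gr0_implies_Suc by blast
        thus ?thesis
          by (simp add: \<phi> e' algebra_simps)
      qed
      finally have 2: "[b (m + p ^ s) = b m * w] (mod p ^ (s + 1))"
        by (simp add: w_def)
      show "\<exists>w. [cprod N (N * (v + p * (m + p ^ s))) = cprod N (N * (v + p * m)) * w] (mod p ^ (s + 1)) \<and>
          [b (m + p ^ s) = b m * w] (mod p ^ (s + 1))"
        using 1 2 by blast
    qed
    have "lip 1 R"
      unfolding R_def by (intro lip_mult lip_1_power P(2) U lip_const Zp_power Zp_of_nat)
    moreover have "B_coeff N (v + p * m) = R m * B_coeff N m" for m
    proof -
      have exp: "f * (v + (p - 1) * m) = f * v + \<phi> * m"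
        by (simp add: algebra_simps flip: f)
      have U_eq: "real (cprod N (N * (v + p * m))) = U m * (real (cprod N (N * m)) * real (cprod p (v + p * m)) ^ \<phi>)"
        using cp[of "v + p * m"] cprod_pos[of N "N * m"] by (simp add: U_def b_def)
      have "B_coeff N (v + p * m) * (real (cprod p (v + p * m)) ^ \<phi> * real p ^ (\<phi> * m) * fact m ^ \<phi>)
        = R m * (real P ^ m * real p ^ (f * m) * real (cprod N (N * m))) * (real (cprod p (v + p * m)) ^ \<phi> * real p ^ (\<phi> * m))"
        using B'[of m] unfolding U_eq exp R_def by (simp only: power_add mult_ac)
      also have "real P ^ m * real p ^ (f * m) * real (cprod N (N * m)) = B_coeff N m * fact m ^ \<phi>"
        using B[of m] by simp
      finally show ?thesis
        using cp[of "v + p * m"] p by (simp add: mult_ac)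
    qed
    ultimately show ?thesis
      by blast
  qed
qed

subsection \<open>The p-adic valuation of the coefficients\<close>

lemma less_p_power_div: "X < p ^ Suc T \<Longrightarrow> X div p < p ^ T"
  by (simp add: div_less_iff_less_mult p_pos mult.commute)

lemma sum_div_power_Suc:
  "(\<Sum>l=1..Suc T. g (X div p ^ l)) = g (X div p) + (\<Sum>l=1..T. g (X div p div p ^ l))"
proof -
  have "(\<Sum>l=1..Suc T. g (X div p ^ l)) = g (X div p) + (\<Sum>l=Suc 1..Suc T. g (X div p ^ l))"
    by (subst sum.atLeast_Suc_atMost) simp_all
  also have "(\<Sum>l=Suc 1..Suc T. g (X div p ^ l)) = (\<Sum>l=1..T. g (X div p div p ^ l))"
    by (subst sum.shift_bounds_cl_Suc_ivl) (simp add: div_mult2_eq)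
  finally show ?thesis .
qed

text \<open>Legendre's formula for restricted factorials, by iterating \<open>cprod_split\<close>;
  \<open>c = 1\<close> is the classical case.\<close>

lemma cprod_valuation:
  assumes "\<not> p dvd c"
  shows "X < p ^ T \<Longrightarrow> \<exists>u. \<not> p dvd u \<and> cprod c X = u * p ^ (\<Sum>l=1..T. ccard c (X div p ^ l))"
proof (induction T arbitrary: X)
  case 0
  thus ?case
    using p_gt_1 by auto
next
  case (Suc T)
  obtain u where u: "\<not> p dvd u"
    "cprod c (X div p) = u * p ^ (\<Sum>l=1..T. ccard c (X div p div p ^ l))"
    using Suc.IH[OF less_p_power_div[OF Suc.prems]] by blast
  have "cprod c X = (cprod (c * p) X * u) * p ^ (\<Sum>l=1..Suc T. ccard c (X div p ^ l))"
    unfolding sum_div_power_Suc[of "ccard c"] using cprod_split[OF assms, of X] u(2)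
    by (simp add: power_add)
  moreover have "\<not> p dvd cprod (c * p) X * u"
    using u(1) not_dvd_cprod[of "c * p" X] prime_p by (simp add: prime_dvd_mult_iff)
  ultimately show ?case
    by blast
qed

text \<open>Sorts the integers prime to \<open>c\<close> by the exact power \<open>p ^ l\<close>
  dividing them; the cofactors are the integers up to \<open>X div p ^ l\<close> prime to
  \<open>d\<close>.\<close>

lemma ccard_valuation:
  assumes "\<not> p dvd c" "\<And>i. coprime i d \<longleftrightarrow> coprime i (c * p)"
  shows "X < p ^ T \<Longrightarrow> ccard c X = ccard d X + (\<Sum>l=1..T. ccard d (X div p ^ l))"
proof (induction T arbitrary: X)
  case (Suc T)
  show ?case
    unfolding sum_div_power_Suc[of "ccard d"]
    using ccard_split[OF assms, of X] Suc.IH[OF less_p_power_div[OF Suc.prems]] by simp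
qed simp

text \<open>One bound for two sources of \<open>p\<close>. If \<open>p\<close> does not divide
  \<open>N\<close>, the power comes from \<open>cprod N\<close>. Otherwise it comes from
  \<open>P_coeff\<close>: counting the integers up to \<open>N * m\<close> prime to
  \<open>N'\<close> in two ways shows that the exponent equals \<open>f * m\<close>.\<close>

lemma B_coeff_numerator_dvd:
  assumes N: "N \<ge> 1" and T: "N * m < p ^ T"
  shows "p ^ (\<Sum>l=1..T. ccard N (N * m div p ^ l)) dvd P_coeff N ^ m * cprod N (N * m)"
proof -
  obtain f P where P: "P_coeff N = p ^ f * P" "\<not> p dvd P"
    "\<not> p dvd N \<longrightarrow> f = 0" "p dvd N \<and> N > 0 \<longrightarrow> f * (p - 1) = totient N"
    by (rule P_coeff_decompose[of N])
  show ?thesis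
  proof (cases "p dvd N")
    case False
    obtain u where "cprod N (N * m) = u * p ^ (\<Sum>l=1..T. ccard N (N * m div p ^ l))"
      using cprod_valuation[OF False T] by blast
    thus ?thesis
      by simp
  next
    case True
    obtain e N' where N': "N = p ^ e * N'" "\<not> p dvd N'"
      using prime_p N by (metis multiplicity_decompose' not_one_le_zero not_prime_unit)
    have "e \<noteq> 0"
      using N' True by (intro notI) simp
    then obtain e' where e': "e = Suc e'"
      using not0_implies_Suc by blast
    have "totient N = totient (p ^ e) * totient N'"
      unfolding N' using N' coprime_p_iff[of N']
      by (intro totient_mult_coprime) (simp add: coprime_commute)
    hence \<phi>: "totient N = p ^ e' * totient N' * (p - 1)"
      using totient_prime_power_Suc[OF prime_p, of e'] by (simp add: e')
    have "f * (p - 1) = p ^ e' * totient N' * (p - 1)"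
      using P(4) True N \<phi> by simp
    hence f: "f = p ^ e' * totient N'"
      using p_gt_1 by simp
    have coprime_N: "coprime i N \<longleftrightarrow> coprime i (N' * p)" for i
      using \<open>e \<noteq> 0\<close> by (auto simp: N')
    have "ccard N' (N * m) = totient N' * (p ^ e * m)"
      using ccard_mult_add[of N' "p ^ e * m" 0] by (simp add: N' mult_ac)
    moreover have "ccard N (N * m) = totient N * m"
      using ccard_mult_add[of N m 0] by simp
    ultimately have "totient N' * (p ^ e * m) = totient N * m + (\<Sum>l=1..T. ccard N (N * m div p ^ l))"
      using ccard_valuation[OF N'(2) coprime_N T] by simp
    moreover have "totient N' * (p ^ e * m) = totient N * m + f * m"
    proof -
      obtain p' where "p = Suc p'"
        using p_pos gr0_implies_Suc by blast
      thus ?thesis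
        by (simp add: \<phi> f e' algebra_simps)
    qed
    ultimately have "(\<Sum>l=1..T. ccard N (N * m div p ^ l)) = f * m"
      by simp
    thus ?thesis
      by (simp add: P(1) power_mult_distrib power_mult)
  qed
qed

text \<open>A Landau-type argument: subtracting Legendre's formula for
  \<open>fact m ^ totient N\<close>, the contribution of \<open>l\<close> is
  \<open>ccard N (N * (m mod p ^ l) div p ^ l)\<close>. It is never negative, and at least 1 if the
  argument is positive, since 1 is prime to \<open>N\<close>.\<close>

lemma B_coeff_valuation:
  assumes N: "N \<ge> 1" and l: "\<And>l. 1 \<le> l \<Longrightarrow> l \<le> \<beta> \<Longrightarrow> N * (m mod p ^ l) \<ge> p ^ l"
  shows "B_coeff N m \<in> ideal (real p ^ \<beta>)"
proof -
  \<comment> \<open>Large enough for \<open>N * m < p ^ T\<close> and for all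
    \<open>l \<le> \<beta>\<close> to occur in the sums up to \<open>T\<close>.\<close>
  define T where "T = N * m + \<beta>"
  define \<phi> where "\<phi> = totient N"
  have m_less: "m \<le> N * m"
    using N by simp
  have "N * m < p ^ (N * m)"
    using power_gt_expt[of p "N * m"] p_gt_1 by simp
  also have "\<dots> \<le> p ^ T"
    using p_gt_1 by (intro power_increasing) (auto simp: T_def)
  finally have T: "N * m < p ^ T" .
  define S where "S = (\<Sum>l=1..T. m div p ^ l)"
  have "\<not> p dvd Suc 0"
    using p_gt_1 by simp
  from cprod_valuation[OF this, of m T] obtain u where u: "\<not> p dvd u" "fact m = u * p ^ S"
    using T m_less by (auto simp: cprod_1 ccard_1 S_def)
  have term_le: "\<phi> * (m div p ^ l) + (if l \<le> \<beta> then 1 else 0) \<le> ccard N (N * m div p ^ l)"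
    if "l \<ge> 1" for l
  proof -
    have "N * m = N * (m mod p ^ l) + p ^ l * (N * (m div p ^ l))"
      by (metis mod_mult_div_eq distrib_left mult.left_commute)
    hence "N * m div p ^ l = N * (m div p ^ l) + N * (m mod p ^ l) div p ^ l"
      using p_pos by simp
    hence "ccard N (N * m div p ^ l) = \<phi> * (m div p ^ l) + ccard N (N * (m mod p ^ l) div p ^ l)"
      by (simp only: ccard_mult_add \<phi>_def)
    moreover have "ccard N (N * (m mod p ^ l) div p ^ l) \<ge> 1" if "l \<le> \<beta>"
      using l[OF \<open>l \<ge> 1\<close> that] p_pos by (intro ccard_pos) (simp add: div_greater_zero_iff Suc_le_eq)
    ultimately show ?thesis
      by simp
  qed
  have "(\<Sum>l=1..T. if l \<le> \<beta> then 1 else 0) = \<beta>"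
  proof -
    have "(\<Sum>l=1..T. if l \<le> \<beta> then 1 else 0) = (\<Sum>l=1..\<beta>. 1 :: nat)"
      by (rule sum.mono_neutral_cong_right) (auto simp: T_def)
    thus ?thesis
      by simp
  qed
  hence "\<phi> * S + \<beta> = (\<Sum>l=1..T. \<phi> * (m div p ^ l) + (if l \<le> \<beta> then 1 else 0))"
    by (simp add: S_def sum.distrib sum_distrib_left)
  also have "\<dots> \<le> (\<Sum>l=1..T. ccard N (N * m div p ^ l))"
    by (intro sum_mono term_le) simp
  finally have "p ^ (\<phi> * S + \<beta>) dvd P_coeff N ^ m * cprod N (N * m)"
    using B_coeff_numerator_dvd[OF N T] power_le_dvd by blast
  then obtain k where "P_coeff N ^ m * cprod N (N * m) = p ^ (\<phi> * S + \<beta>) * k"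
    by (elim dvdE)
  hence "B_coeff N m * fact m ^ \<phi> = real p ^ \<beta> * real k * real p ^ (\<phi> * S)"
    unfolding \<phi>_def using B_coeff_eq[OF N, of m] by (simp add: power_add)
  moreover have "(fact m :: real) = real u * real p ^ S"
    using arg_cong[OF u(2), of real] by simp
  hence "(fact m :: real) ^ \<phi> = real u ^ \<phi> * real p ^ (\<phi> * S)"
    by (simp add: power_mult_distrib mult.commute flip: power_mult)
  ultimately have "B_coeff N m * real u ^ \<phi> = real p ^ \<beta> * real k"
    using p_pos by simp
  moreover have "u > 0"
    using u(1) by (intro Nat.gr0I) auto
  ultimately have "B_coeff N m = real p ^ \<beta> * (real k / real (u ^ \<phi>))"
    by (simp add: field_simps)
  moreover have "real k / real (u ^ \<phi>) \<in> Zp"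
    by (intro Zp_divide_nat Zp_of_nat not_dvd_power u(1))
  ultimately show ?thesis
    by (metis idealI)
qed

text \<open>If \<open>p ^ \<alpha>\<close> exactly divides \<open>L * j + e\<close>, then for
  \<open>l \<le> \<alpha> + 1\<close> and \<open>r = j mod p ^ (l - 1)\<close> also
  \<open>p ^ (l - 1)\<close> divides \<open>L * r + e\<close>. Hence \<open>p ^ l \<le> p * (L * r +
  e) \<le> L * (a + p * r) \<le> N * (a + p * r)\<close>, and \<open>B_coeff_valuation\<close>
  yields \<open>\<alpha> + 1\<close> factors \<open>p\<close>.\<close>

lemma B_coeff_divide_Zp:
  assumes a: "a < p" and e: "e \<ge> 1" "p * e \<le> L * a" and L: "L \<ge> 1" "L \<le> N"
  shows "B_coeff N (a + p * j) / real (p * (L * j + e)) \<in> Zp"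
proof -
  have pos: "L * j + e > 0"
    using e by simp
  then obtain \<alpha> w where w: "L * j + e = p ^ \<alpha> * w" "\<not> p dvd w"
    using prime_p by (metis multiplicity_decompose' not_gr_zero not_prime_unit)
  have "B_coeff N (a + p * j) \<in> ideal (real p ^ (\<alpha> + 1))"
  proof (rule B_coeff_valuation)
    fix l assume l: "1 \<le> l" "l \<le> \<alpha> + 1"
    define r where "r = j mod p ^ (l - 1)"
    have l_eq: "p ^ l = p * p ^ (l - 1)"
      using l by (cases l) simp_all
    have "p ^ (l - 1) dvd L * j + e"
      unfolding w using l by (intro dvd_mult2 le_imp_power_dvd) auto
    moreover have "L * j + e = p ^ (l - 1) * (L * (j div p ^ (l - 1))) + (L * r + e)"
      unfolding r_def by (metis add.assoc mult_div_mod_eq distrib_left mult.left_commute)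
    ultimately have "p ^ (l - 1) dvd L * r + e"
      by (metis dvd_add_right_iff dvd_triv_left)
    hence "p ^ (l - 1) \<le> L * r + e"
      using e by (intro dvd_imp_le) auto
    hence "p * p ^ (l - 1) \<le> p * (L * r + e)"
      by (rule mult_le_mono2)
    also have "\<dots> \<le> L * (a + p * r)"
      using e(2) by (simp add: algebra_simps)
    also have "\<dots> \<le> N * (a + p * r)"
      using L(2) by (rule mult_le_mono1)
    also have "a + p * r = (a + p * j) mod p ^ l"
      unfolding l_eq r_def mod_mult2_eq using a by simp
    finally show "N * ((a + p * j) mod p ^ l) \<ge> p ^ l"
      by (simp only: l_eq)
  qed (use L in simp)
  then obtain c where c: "c \<in> Zp" "B_coeff N (a + p * j) = real p ^ (\<alpha> + 1) * c"
    by (rule idealE)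
  have "B_coeff N (a + p * j) / real (p * (L * j + e)) = c / real w"
    unfolding c(2) w(1) using p_pos by simp
  thus ?thesis
    using Zp_divide_nat[OF c(1) w(2)] by simp
qed

subsection \<open>Harmonic numbers\<close>

text \<open>In \<open>p * harm n\<close> the terms \<open>p / i\<close> with \<open>i\<close> prime
  to \<open>p\<close> vanish modulo \<open>p\<close>, and those with \<open>i = p * i'\<close>
  become \<open>1 / i'\<close>.\<close>

lemma p_harm_cong: "real p * harm n - harm (n div p) \<in> ideal p"
proof (induction n)
  case (Suc n)
  show ?case
  proof (cases "p dvd Suc n")
    case True
    then obtain k where k: "Suc n = p * k"
      by (elim dvdE)
    have div: "Suc n div p = Suc (n div p)"
      using True by (simp add: div_Suc dvd_eq_mod_eq_0)
    hence "k = Suc (n div p)"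
      using k p_pos by simp
    with k have "Suc n = p * Suc (n div p)"
      by simp
    hence eq: "real (Suc n) = real p * real (Suc (n div p))"
      by (simp only: of_nat_mult)
    have "real p * inverse (real (Suc n)) = inverse (real (Suc (n div p)))"
      unfolding eq using p_pos by (simp add: field_simps del: of_nat_Suc)
    thus ?thesis
      using Suc.IH by (simp add: div harm_Suc distrib_left del: of_nat_Suc)
  next
    case False
    hence div: "Suc n div p = n div p"
      by (auto simp: div_Suc dvd_eq_mod_eq_0)
    have "real p * inverse (real (Suc n)) \<in> ideal p"
      using Zp_inverse_nat[OF False] by (intro idealI) (simp add: inverse_eq_divide del: of_nat_Suc)
    from ideal_add[OF Suc.IH this] show ?thesis
      by (simp add: div harm_Suc distrib_left algebra_simps del: of_nat_Suc)
  qed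
qed (simp add: harm_def)

lemma harm_diff: "m \<le> n \<Longrightarrow> harm n - harm m = (\<Sum>i\<in>{m<..n}. 1 / real i)"
  by (induction n rule: dec_induct)
    (simp_all add: harm_Suc inverse_eq_divide flip: atLeastSucAtMost_greaterThanAtMost)

end

text \<open>The numbers \<open>p * (L * j + e)\<close> in \<open>divide_Zp\<close> are the multiples
  of \<open>p\<close> beyond \<open>L * (p * j)\<close> and up to
  \<open>L * (a + p * j)\<close>.\<close>

locale harmonic_dwork = dwork_sequence +
  fixes L :: nat
  assumes divide_Zp: "a < p \<Longrightarrow> e \<ge> 1 \<Longrightarrow> p * e \<le> L * a \<Longrightarrow> B (a + p * j) / real (p * (L * j + e)) \<in> Zp"
begin

text \<open>The hypothesis of \<open>weighted_congruence\<close>, checked on each term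
  \<open>1 / i\<close> of the difference: if \<open>p ^ (s + 1)\<close> does not divide
  \<open>i\<close>, then \<open>p ^ s / i\<close> is \<open>p\<close>-integral; otherwise
  \<open>i = p ^ s * (p * (L * j + e))\<close> and \<open>divide_Zp\<close> applies.\<close>

lemma harm_weight:
  "B m * real p ^ s * (harm (L * (p ^ s * m)) - harm (L * (p ^ (s + 1) * (m div p)))) \<in> Zp"
proof -
  define a where "a = m mod p"
  define j where "j = m div p"
  have m: "m = a + p * j" and a: "a < p"
    using p_pos by (auto simp: a_def j_def)
  have eq: "L * (p ^ s * m) = L * (p ^ (s + 1) * j) + p ^ s * (L * a)"
    by (simp add: m algebra_simps)
  have "B m * real p ^ s * (1 / real i) \<in> Zp"
    if i: "i \<in> {L * (p ^ (s + 1) * j)<..L * (p ^ s * m)}" for i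
  proof (cases "p ^ (s + 1) dvd i")
    case True
    then obtain i' where i': "i = p ^ (s + 1) * i'"
      by (elim dvdE)
    have "p ^ (s + 1) * (L * j) < p ^ (s + 1) * i'"
      using i by (simp add: i' mult_ac)
    hence "L * j < i'"
      by simp
    define e where "e = i' - L * j"
    have e: "i' = L * j + e" "e \<ge> 1"
      using \<open>L * j < i'\<close> by (auto simp: e_def)
    have "p ^ s * (p * e) \<le> p ^ s * (L * a)"
      using i unfolding i' e eq by (simp add: algebra_simps)
    hence "p * e \<le> L * a"
      using p_pos by simp
    note * = divide_Zp[OF a e(2) this, of j]
    have "real i = real p ^ s * real (p * (L * j + e))"
      by (simp add: i' e(1))
    thus ?thesis
      using * p_pos by (simp add: m del: of_nat_mult of_nat_add)
  next
    case False
    have "i > 0"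
      using i by simp
    then obtain t i' where i': "i = p ^ t * i'" "\<not> p dvd i'"
      using prime_p by (metis multiplicity_decompose' not_gr_zero not_prime_unit)
    have "t \<le> s"
      using False i' by (metis Suc_eq_plus1 dvd_mult2 le_imp_power_dvd not_less_eq_eq)
    then obtain d where d: "s = t + d"
      using le_Suc_ex by blast
    have "B m * real p ^ s * (1 / real i) = B m * real p ^ d / real i'"
      using p_pos by (simp add: i'(1) d power_add)
    thus ?thesis
      using i'(2) by (auto intro!: Zp_divide_nat B_Zp)
  qed
  hence "(\<Sum>i\<in>{L * (p ^ (s + 1) * j)<..L * (p ^ s * m)}. B m * real p ^ s * (1 / real i)) \<in> Zp"
    by (rule Zp_sum)
  also have "(\<Sum>i\<in>{L * (p ^ (s + 1) * j)<..L * (p ^ s * m)}. B m * real p ^ s * (1 / real i))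
    = B m * real p ^ s * (harm (L * (p ^ s * m)) - harm (L * (p ^ (s + 1) * j)))"
    unfolding sum_distrib_left[symmetric] by (subst harm_diff) (simp_all add: eq)
  finally show ?thesis
    by (simp add: j_def)
qed

text \<open>By \<open>p_harm_cong\<close> the first harmonic number may be replaced by
  \<open>harm (L * j + L * a div p)\<close>. The surplus terms are \<open>1 / (L * j + e)\<close>
  with \<open>p * e \<le> L * a\<close>, which \<open>B (a + p * j)\<close> cancels with a factor
  \<open>p\<close> to spare.\<close>

lemma harm_shift:
  assumes a: "a < p"
  shows "B (a + p * j) * (real p * harm (L * (a + p * j)) - harm (L * j)) \<in> ideal p"
proof -
  define n where "n = L * (a + p * j)"
  have "n = L * a + p * (L * j)"
    by (simp add: n_def algebra_simps)
  hence n: "n div p = L * j + L * a div p"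
    using p_pos by simp
  have "B (a + p * j) * (1 / real i) \<in> ideal p" if "i \<in> {L * j<..n div p}" for i
  proof -
    define e where "e = i - L * j"
    have e: "i = L * j + e" "e \<ge> 1" "e \<le> L * a div p"
      using that by (auto simp: e_def n)
    have "p * e \<le> p * (L * a div p)"
      using e(3) by (rule mult_le_mono2)
    also have "\<dots> \<le> L * a"
      by simp
    finally have "p * e \<le> L * a" .
    from idealI[OF divide_Zp[OF a e(2) this, of j], of "real p"]
    show ?thesis
      using p_pos by (simp add: e(1))
  qed
  hence "(\<Sum>i\<in>{L * j<..n div p}. B (a + p * j) * (1 / real i)) \<in> ideal p"
    by (rule ideal_sum)
  hence "B (a + p * j) * (harm (n div p) - harm (L * j)) \<in> ideal p"
    unfolding sum_distrib_left[symmetric] by (subst harm_diff) (simp_all add: n)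
  from ideal_add[OF this ideal_scale[OF B_Zp p_harm_cong[of n], of "a + p * j"]]
  show ?thesis
    by (simp add: n_def algebra_simps)
qed

lemma convolution_congruence:
  assumes a: "a < p"
  shows "(\<Sum>j\<le>K. B (a + p * j) * B (K - j) * (harm (L * (K - j)) - real p * harm (L * (a + p * j)))) \<in> ideal p"
proof -
  define w :: "nat \<Rightarrow> real" where "w j = harm (L * j)" for j
  have "(\<Sum>j\<le>K. w j * (B j * B (K - j) * (R a j - R a (K - j)))) \<in> ideal p"
    by (rule weighted_congruence[OF R_lip[OF a]]) (use harm_weight in \<open>simp_all add: w_def harm_def\<close>)
  hence 1: "- (\<Sum>j\<le>K. w j * (B j * B (K - j) * (R a j - R a (K - j)))) \<in> ideal p"
    by (rule ideal_minus)
  \<comment> \<open>Reflecting \<open>j\<close> to \<open>K - j\<close> trades a weight difference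
    for a difference of the ratio \<open>R a\<close>, the form that
    \<open>weighted_congruence\<close> treats.\<close>
  have "(\<Sum>j\<le>K. B j * B (K - j) * R a j * w (K - j)) = (\<Sum>j\<le>K. B j * B (K - j) * R a (K - j) * w j)"
    by (rule sum.reindex_bij_witness[of _ "\<lambda>j. K - j" "\<lambda>j. K - j"]) auto
  hence "- (\<Sum>j\<le>K. w j * (B j * B (K - j) * (R a j - R a (K - j))))
    = (\<Sum>j\<le>K. B j * B (K - j) * R a j * w (K - j)) - (\<Sum>j\<le>K. B j * B (K - j) * R a j * w j)"
    by (simp add: right_diff_distrib left_diff_distrib sum_subtractf mult_ac)
  also have "\<dots> = (\<Sum>j\<le>K. B (a + p * j) * B (K - j) * (w (K - j) - w j))"
    unfolding B_rec[OF a] by (simp add: right_diff_distrib sum_subtractf mult_ac)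
  finally have "(\<Sum>j\<le>K. B (a + p * j) * B (K - j) * (w (K - j) - w j)) \<in> ideal p"
    using 1 by simp
  moreover have "(\<Sum>j\<le>K. B (K - j) * (B (a + p * j) * (real p * w (a + p * j) - w j))) \<in> ideal p"
    unfolding w_def by (intro ideal_sum ideal_scale B_Zp harm_shift a)
  ultimately have "(\<Sum>j\<le>K. B (a + p * j) * B (K - j) * (w (K - j) - w j)) -
      (\<Sum>j\<le>K. B (K - j) * (B (a + p * j) * (real p * w (a + p * j) - w j))) \<in> ideal p"
    by (rule ideal_diff)
  moreover have "(\<Sum>j\<le>K. B (a + p * j) * B (K - j) * (w (K - j) - w j)) -
      (\<Sum>j\<le>K. B (K - j) * (B (a + p * j) * (real p * w (a + p * j) - w j)))
    = (\<Sum>j\<le>K. B (a + p * j) * B (K - j) * (w (K - j) - real p * w (a + p * j)))"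
    unfolding sum_subtractf[symmetric] by (intro sum.cong refl) (simp add: algebra_simps)
  ultimately show ?thesis
    by (simp add: w_def)
qed

end

subsection \<open>Integrality of exponentials of power series\<close>

lemma fps_deriv_linear_ODE_eq_0:
  fixes D g :: "real fps"
  assumes "fps_deriv D = D * g" "D $ 0 = 0"
  shows "D = 0"
proof -
  have "D $ n = 0" for n
  proof (induction n rule: less_induct)
    case (less n)
    show ?case
    proof (cases n)
      case (Suc m)
      have "fps_deriv D $ m = (\<Sum>i=0..m. D $ i * g $ (m - i))"
        unfolding assms(1) by (rule fps_mult_nth)
      also have "\<dots> = 0"
        using less by (intro sum.neutral) (auto simp: Suc)
      finally show ?thesis
        by (simp add: Suc)
    qed (simp add: assms(2))
  qed
  thus ?thesis
    by (simp add: fps_eq_iff)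
qed

text \<open>Both sides have constant term 1 and solve \<open>y' = y * (g' + h')\<close>, so their
  difference vanishes by uniqueness.\<close>

lemma fps_exp_compose_add:
  fixes g h :: "real fps"
  assumes "g $ 0 = 0" "h $ 0 = 0"
  shows "fps_exp 1 oo (g + h) = (fps_exp 1 oo g) * (fps_exp 1 oo h)"
proof -
  have deriv: "fps_deriv (fps_exp 1 oo f) = (fps_exp 1 oo f) * fps_deriv f" if "f $ 0 = 0" for f :: "real fps"
    using fps_compose_deriv[OF that, of "fps_exp 1"] by simp
  define D where "D = (fps_exp 1 oo (g + h)) - (fps_exp 1 oo g) * (fps_exp 1 oo h)"
  have "fps_deriv D = D * (fps_deriv g + fps_deriv h)"
    using assms by (simp add: D_def deriv algebra_simps)
  hence "D = 0"
    by (rule fps_deriv_linear_ODE_eq_0) (simp add: D_def)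
  thus ?thesis
    by (simp add: D_def)
qed

lemma fps_exp_compose_of_nat_mult:
  fixes h :: "real fps"
  assumes "h $ 0 = 0"
  shows "fps_exp 1 oo (of_nat n * h) = (fps_exp 1 oo h) ^ n"
proof (induction n)
  case (Suc n)
  have "fps_exp 1 oo (h + of_nat n * h) = (fps_exp 1 oo h) * (fps_exp 1 oo (of_nat n * h))"
    using assms by (intro fps_exp_compose_add) auto
  moreover have "of_nat (Suc n) * h = h + of_nat n * h"
    by (simp add: algebra_simps)
  ultimately show ?case
    by (simp only: Suc.IH power_Suc)
qed (simp add: fps_eq_iff fps_compose_nth fps_one_def)

section \<open>Frobenius congruences and the criterion of Dieudonne and Dwork\<close>

context prime_place
begin

lemma Zp_power_p_cong:
  assumes "c \<in> Zp"
  shows "c ^ p - c \<in> ideal p"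
proof -
  have nat: "[a ^ p = a] (mod p)" for a :: nat
  proof (cases "p dvd a")
    case True
    moreover have "p dvd a ^ p"
      using True p_pos by (meson dvd_power dvd_trans)
    ultimately show ?thesis
      by (simp add: cong_def)
  next
    case False
    have "[a ^ (p - 1) * a = 1 * a] (mod p)"
      by (intro cong_scalar_right fermat_theorem prime_p False)
    thus ?thesis
      using p_pos by (metis mult_1 power_minus_mult)
  qed
  have int: "[a ^ p = a] (mod int p)" for a :: int
  proof -
    define k where "k = nat (a mod int p)"
    have k: "[a = int k] (mod int p)"
      using p_pos by (simp add: k_def cong_def)
    have "[a ^ p = int k ^ p] (mod int p)"
      using k by (rule cong_pow)
    also have "[int k ^ p = int k] (mod int p)"
      using nat[of k] by (metis cong_int_iff of_nat_power)
    also have "[int k = a] (mod int p)"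
      using k by (rule cong_sym)
    finally show ?thesis .
  qed
  obtain a b where c: "\<not> p dvd b" "c = of_int a / of_nat b"
    using assms unfolding Zp_def by blast
  have "[a ^ p * int b = a * int b ^ p] (mod int p)"
    using int[of a] int[of "int b"] by (intro cong_mult) (auto intro: cong_sym)
  then obtain k where "a ^ p * int b - a * int b ^ p = int p * k"
    by (meson cong_iff_dvd_diff dvd_def)
  hence "of_int (a ^ p * int b - a * int b ^ p) = (of_int (int p * k) :: real)"
    by simp
  hence k: "of_int a ^ p * real b - of_int a * real b ^ p = real p * of_int k"
    by simp
  have "b > 0"
    using c by (intro Nat.gr0I) auto
  hence "c ^ p - c = (of_int a ^ p * real b - of_int a * real b ^ p) / real (b ^ (p + 1))"
    by (simp add: c(2) field_simps)
  also have "\<dots> = real p * (of_int k / real (b ^ (p + 1)))"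
    by (simp only: k times_divide_eq_right)
  also have "\<dots> \<in> ideal p"
    by (intro idealI Zp_divide_nat not_dvd_power c) auto
  finally show ?thesis .
qed

text \<open>Induction from \<open>i\<close> to \<open>m = i div p\<close>: \<open>fact i\<close> is
  a unit times \<open>p ^ m * fact m\<close>, and \<open>2 * m \<le> i\<close> leaves enough powers
  of \<open>p\<close> to retain \<open>p ^ m / fact m\<close>. This covers \<open>p = 2\<close> as
  well.\<close>

lemma p_power_div_fact: "i \<ge> 1 \<Longrightarrow> real p ^ i / fact i \<in> ideal p"
proof (induction i rule: less_induct)
  case (less i)
  define v where "v = i mod p"
  define m where "m = i div p"
  have i: "i = v + p * m" and v: "v < p"
    using p_pos by (auto simp: v_def m_def)
  have u: "\<not> p dvd cprod p i"
    by (rule not_dvd_cprod) simp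
  have "fact i = cprod p i * p ^ m * fact m"
    unfolding i by (rule fact_split[OF v])
  from arg_cong[OF this, of real]
  have fact: "(fact i :: real) = real (cprod p i) * real p ^ m * fact m"
    by simp
  show ?case
  proof (cases "m = 0")
    case True
    have "real p ^ i / fact i = real p * (real p ^ (i - 1) / real (cprod p i))"
      unfolding fact using less.prems True by (simp flip: power_Suc)
    also have "\<dots> \<in> ideal p"
      by (intro idealI Zp_divide_nat u Zp_power Zp_of_nat)
    finally show ?thesis .
  next
    case False
    have "2 * m \<le> p * m"
      using p_gt_1 by simp
    hence "2 * m \<le> i"
      using i by linarith
    hence pow: "real p ^ i = real p ^ (i - 2 * m) * real p ^ m * real p ^ m"
      by (simp flip: power_add)
    have "m < i"
      using False \<open>2 * m \<le> i\<close> by simp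
    hence "real p ^ m / fact m \<in> ideal p"
      using less.IH[of m] False by simp
    moreover have "real p ^ i / fact i = real p ^ (i - 2 * m) / real (cprod p i) * (real p ^ m / fact m)"
      unfolding fact pow using p_pos by simp
    ultimately show ?thesis
      by (simp only:) (intro ideal_scale Zp_divide_nat u Zp_power Zp_of_nat)
  qed
qed

definition ZpX :: "real fps set" where
  "ZpX = {f. \<forall>n. f $ n \<in> Zp}"

definition pZpX :: "real fps set" where
  "pZpX = {f. \<forall>n. f $ n \<in> ideal p}"

lemma ZpX_mult: "f \<in> ZpX \<Longrightarrow> g \<in> ZpX \<Longrightarrow> f * g \<in> ZpX"
  by (auto simp: ZpX_def fps_mult_nth)

lemma ZpX_power: "f \<in> ZpX \<Longrightarrow> f ^ n \<in> ZpX"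
proof (induction n)
  case 0
  thus ?case by (auto simp: ZpX_def fps_one_def)
qed (simp add: ZpX_mult)

lemma pZpX_mult: "f \<in> ZpX \<Longrightarrow> g \<in> pZpX \<Longrightarrow> f * g \<in> pZpX"
  by (auto simp: ZpX_def pZpX_def fps_mult_nth)

lemma pZpX_add: "f \<in> pZpX \<Longrightarrow> g \<in> pZpX \<Longrightarrow> f + g \<in> pZpX"
  by (auto simp: pZpX_def)

lemma pZpX_sum: "(\<And>i. i \<in> A \<Longrightarrow> f i \<in> pZpX) \<Longrightarrow> sum f A \<in> pZpX"
  by (auto simp: pZpX_def fps_sum_nth)

lemma pZpX_of_nat_mult: "p dvd n \<Longrightarrow> f \<in> ZpX \<Longrightarrow> of_nat n * f \<in> pZpX"
  by (auto simp: ZpX_def pZpX_def fps_mult_of_nat_nth mult.assoc elim!: dvdE intro!: idealI Zp_mult)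

lemma ZpX_inverse:
  fixes f :: "real fps"
  assumes f: "f \<in> ZpX" "f $ 0 = 1"
  shows "inverse f \<in> ZpX"
proof -
  have "inverse f $ n \<in> Zp" for n
  proof (induction n rule: less_induct)
    case (less n)
    show ?case
    proof (cases n)
      case 0
      thus ?thesis by (simp add: f)
    next
      case (Suc m)
      have "0 = (f * inverse f) $ n"
        using f by (simp add: inverse_mult_eq_1' Suc)
      also have "\<dots> = inverse f $ n + (\<Sum>i=1..n. f $ i * inverse f $ (n - i))"
        by (simp add: fps_mult_nth sum.atLeast_Suc_atMost f)
      finally have "inverse f $ n = - (\<Sum>i=1..n. f $ i * inverse f $ (n - i))"
        by simp
      also have "\<dots> \<in> Zp"
        using f less by (intro Zp_minus Zp_sum Zp_mult) (auto simp: ZpX_def)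
      finally show ?thesis .
    qed
  qed
  thus ?thesis
    by (simp add: ZpX_def)
qed

lemma frobenius_add:
  assumes f: "f \<in> ZpX" and g: "g \<in> ZpX"
  shows "(f + g) ^ p - f ^ p - g ^ p \<in> pZpX"
proof -
  define t where "t k = of_nat (p choose k) * f ^ k * g ^ (p - k)" for k
  have "{..p} = insert 0 (insert p {1..<p})"
    using p_pos by auto
  hence "(f + g) ^ p = t 0 + (t p + (\<Sum>k\<in>{1..<p}. t k))"
    unfolding binomial_ring t_def[symmetric] using p_pos by simp
  hence "(f + g) ^ p - f ^ p - g ^ p = (\<Sum>k\<in>{1..<p}. t k)"
    by (simp add: t_def)
  also have "\<dots> \<in> pZpX"
  proof (rule pZpX_sum)
    fix k assume "k \<in> {1..<p}"
    hence "p dvd (p choose k)"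
      using prime_p by (intro dvd_choose_prime) auto
    thus "t k \<in> pZpX"
      unfolding t_def mult.assoc by (intro pZpX_of_nat_mult ZpX_mult ZpX_power f g)
  qed
  finally show ?thesis .
qed

text \<open>The congruence of \<open>f ^ p\<close> and \<open>f(X^p)\<close> modulo
  \<open>p\<close>, adding one monomial at a time. Truncation matters because the criterion uses it
  while only the coefficients below \<open>n\<close> are known to be
  \<open>p\<close>-integral.\<close>

lemma frobenius_cutoff:
  fixes f :: "real fps"
  assumes f: "\<And>i. i < n \<Longrightarrow> f $ i \<in> Zp"
  shows "fps_cutoff n f ^ p - (fps_cutoff n f oo fps_X ^ p) \<in> pZpX"
  using f
proof (induction n)
  case 0
  thus ?case
    using p_pos by (simp add: pZpX_def zero_power)
next
  case (Suc n)
  define g where "g = fps_cutoff n f"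
  define h where "h = fps_const (f $ n) * fps_X ^ n"
  have Suc_n: "fps_cutoff (Suc n) f = g + h"
    by (auto simp: fps_eq_iff g_def h_def less_Suc_eq)
  have g: "g \<in> ZpX" and h: "h \<in> ZpX"
    using Suc.prems by (auto simp: ZpX_def g_def h_def)
  have "h ^ p = fps_const ((f $ n) ^ p) * fps_X ^ (n * p)"
    by (simp add: h_def power_mult_distrib fps_const_power power_mult)
  moreover have "h oo fps_X ^ p = fps_const (f $ n) * fps_X ^ (n * p)"
    using p_pos by (auto simp: fps_eq_iff fps_nth_compose_X_power h_def)
  ultimately have "h ^ p - (h oo fps_X ^ p) = fps_const ((f $ n) ^ p - f $ n) * fps_X ^ (n * p)"
    by (simp add: fps_eq_iff)
  moreover have "(f $ n) ^ p - f $ n \<in> ideal p"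
    using Suc.prems by (intro Zp_power_p_cong) simp
  ultimately have "h ^ p - (h oo fps_X ^ p) \<in> pZpX"
    by (simp add: pZpX_def)
  moreover have "g ^ p - (g oo fps_X ^ p) \<in> pZpX"
    unfolding g_def using Suc by simp
  ultimately have "((g + h) ^ p - g ^ p - h ^ p) + ((g ^ p - (g oo fps_X ^ p)) + (h ^ p - (h oo fps_X ^ p))) \<in> pZpX"
    by (intro pZpX_add frobenius_add g h)
  thus ?case
    unfolding Suc_n by (simp add: fps_compose_add_distrib algebra_simps)
qed

text \<open>With constant term 1, the coefficient \<open>f $ n\<close> enters
  \<open>(f ^ k) $ n\<close> only linearly, once from each of the \<open>k\<close> factors.\<close>

lemma fps_power_nth_cutoff:
  fixes f :: "real fps"
  assumes f0: "f $ 0 = 1" and n: "n \<ge> 1"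
  shows "i < n \<Longrightarrow> (f ^ k) $ i = (fps_cutoff n f ^ k) $ i"
    and "(f ^ k) $ n = (fps_cutoff n f ^ k) $ n + real k * f $ n"
proof -
  define g where "g = fps_cutoff n f"
  have less: "(f ^ k) $ i = (g ^ k) $ i" if "i < n" for i k
    using that
  proof (induction k arbitrary: i)
    case (Suc k)
    have "(f * f ^ k) $ i = (g * g ^ k) $ i"
      unfolding fps_mult_nth using Suc by (intro sum.cong) (auto simp: g_def)
    thus ?case
      by (simp only: power_Suc)
  qed simp
  show "i < n \<Longrightarrow> (f ^ k) $ i = (fps_cutoff n f ^ k) $ i"
    using less by (simp add: g_def)
  have split: "{0..n} = insert 0 (insert n {1..<n})"
    using n by auto
  show "(f ^ k) $ n = (fps_cutoff n f ^ k) $ n + real k * f $ n"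
    unfolding g_def[symmetric]
  proof (induction k)
    case (Suc k)
    have g: "g $ 0 = 1" "g $ n = 0" "\<And>i. i < n \<Longrightarrow> g $ i = f $ i"
      using n f0 by (auto simp: g_def)
    have "(f * f ^ k) $ n = (f ^ k) $ n + (f $ n + (\<Sum>i\<in>{1..<n}. f $ i * (f ^ k) $ (n - i)))"
      unfolding fps_mult_nth split using n by (simp add: f0 fps_power_zeroth)
    also have "(\<Sum>i\<in>{1..<n}. f $ i * (f ^ k) $ (n - i)) = (\<Sum>i\<in>{1..<n}. g $ i * (g ^ k) $ (n - i))"
      using less by (intro sum.cong refl) (simp add: g)
    also have "(\<Sum>i\<in>{1..<n}. g $ i * (g ^ k) $ (n - i)) = (g * g ^ k) $ n - (g ^ k) $ n"
      unfolding fps_mult_nth split using n by (simp add: g)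
    also have "(f ^ k) $ n + (f $ n + ((g * g ^ k) $ n - (g ^ k) $ n))
        = (g * g ^ k) $ n + real (Suc k) * f $ n"
      unfolding Suc.IH by (simp add: algebra_simps)
    finally show ?case
      by (simp only: power_Suc)
  qed simp
qed

text \<open>Comparing coefficients at \<open>n\<close> expresses \<open>p * f $ n\<close> through
  lower coefficients of \<open>f\<close> and those of \<open>V\<close>. By
  \<open>frobenius_cutoff\<close> and the divisibility of \<open>V\<close> this is a multiple of
  \<open>p\<close>, so \<open>f $ n\<close> is \<open>p\<close>-integral.\<close>

lemma dieudonne_dwork:
  fixes f V :: "real fps"
  assumes f0: "f $ 0 = 1" and eq: "f oo fps_X ^ p = f ^ p * V"
    and V: "V $ 0 = 1" "\<And>n. n \<ge> 1 \<Longrightarrow> V $ n \<in> ideal p"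
  shows "f \<in> ZpX"
proof -
  have "f $ n \<in> Zp" for n
  proof (induction n rule: less_induct)
    case (less n)
    show ?case
    proof (cases "n = 0")
      case False
      hence n: "n \<ge> 1"
        by simp
      define g where "g = fps_cutoff n f"
      have g: "g \<in> ZpX"
        using less by (simp add: ZpX_def g_def)
      have "n div p < n"
        using n p_gt_1 by simp
      hence "(f oo fps_X ^ p) $ n = (g oo fps_X ^ p) $ n"
        using p_pos by (simp add: fps_nth_compose_X_power g_def)
      moreover have "(f ^ p * V) $ n = (f ^ p) $ n + (\<Sum>i<n. (f ^ p) $ i * V $ (n - i))"
        by (simp add: fps_mult_nth atLeast0AtMost V(1) flip: lessThan_Suc_atMost)
      moreover have "(f ^ p) $ n = (g ^ p) $ n + real p * f $ n"
        unfolding g_def by (rule fps_power_nth_cutoff(2)[OF f0 n])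
      ultimately have "real p * f $ n = - ((g ^ p - (g oo fps_X ^ p)) $ n + (\<Sum>i<n. (f ^ p) $ i * V $ (n - i)))"
        using eq by simp
      also have "\<dots> \<in> ideal p"
      proof (intro ideal_minus ideal_add ideal_sum ideal_scale)
        show "(g ^ p - (g oo fps_X ^ p)) $ n \<in> ideal p"
          using frobenius_cutoff[of n f] less by (simp add: pZpX_def g_def)
        fix i assume i: "i \<in> {..<n}"
        thus "V $ (n - i) \<in> ideal p"
          by (intro V) auto
        show "(f ^ p) $ i \<in> Zp"
          using ZpX_power[OF g, of p] fps_power_nth_cutoff(1)[OF f0 n, of i p] i
          by (simp add: ZpX_def g_def)
      qed
      finally have "real p * f $ n \<in> ideal (real p * 1)"
        by simp
      from ideal_p_cancel[OF this] show ?thesis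
        by simp
    qed (simp add: f0)
  qed
  thus ?thesis
    by (simp add: ZpX_def)
qed

lemma fps_exp_compose_pZpX:
  assumes h: "h \<in> pZpX" and n: "n \<ge> 1"
  shows "(fps_exp 1 oo h) $ n \<in> ideal p"
proof -
  define t where "t = fps_const (1 / real p) * h"
  have ht: "h = fps_const (real p) * t"
    using p_pos by (simp add: t_def flip: mult.assoc)
  have "real p * t $ m \<in> ideal (real p * 1)" for m
    using h by (simp add: ht pZpX_def)
  hence t: "t \<in> ZpX"
    using ideal_p_cancel[of _ 1] by (simp add: ZpX_def)
  have "(fps_exp 1 oo h) $ n = (\<Sum>i=0..n. (real p ^ i / fact i) * (t ^ i) $ n)"
    by (simp add: fps_compose_nth ht power_mult_distrib fps_const_power)
  also have "\<dots> \<in> ideal p"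
  proof (rule ideal_sum)
    fix i
    show "(real p ^ i / fact i) * (t ^ i) $ n \<in> ideal p"
    proof (cases "i = 0")
      case False
      thus ?thesis
        using ZpX_power[OF t, of i] by (intro ideal_scale' p_power_div_fact) (auto simp: ZpX_def)
    qed (use n in simp)
  qed
  finally show ?thesis .
qed

text \<open>For \<open>h = G / F\<close>, dividing the hypothesis by \<open>F\<close> and
  \<open>F(X^p)\<close> shows that \<open>d = h(X^p) - p * h\<close> vanishes modulo
  \<open>p\<close>. Then \<open>f = exp h\<close> satisfies \<open>f(X^p) = f ^ p * exp d\<close>,
  as the criterion demands.\<close>

lemma fps_exp_divide_ZpX:
  fixes F G :: "real fps"
  assumes F: "F \<in> ZpX" "F $ 0 = 1" and G: "G $ 0 = 0"
    and FG: "F * (G oo fps_X ^ p) - of_nat p * ((F oo fps_X ^ p) * G) \<in> pZpX"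
  shows "fps_exp 1 oo (G / F) \<in> ZpX"
proof -
  define h where "h = G / F"
  have h0: "h $ 0 = 0"
    using F G by (simp add: h_def fps_divide_unit)
  have X: "(fps_X ^ p :: real fps) $ 0 = 0"
    using p_pos by simp
  define F' G' h' where "F' = F oo fps_X ^ p" and "G' = G oo fps_X ^ p" and "h' = h oo fps_X ^ p"
  have hF: "h * F = G"
    using F by (simp add: h_def fps_divide_unit inverse_mult_eq_1)
  hence h'F': "h' * F' = G'"
    unfolding F'_def G'_def h'_def by (simp add: fps_compose_mult_distrib[OF X, symmetric])
  have F': "F' \<in> ZpX" "F' $ 0 = 1"
    using F p_pos by (auto simp: F'_def ZpX_def fps_nth_compose_X_power)
  define d where "d = h' - of_nat p * h"
  have "inverse F' * (inverse F * (F * G' - of_nat p * (F' * G))) \<in> pZpX"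
    using FG unfolding F'_def[symmetric] G'_def[symmetric]
    by (intro pZpX_mult ZpX_inverse F F')
  also have "inverse F' * (inverse F * (F * G' - of_nat p * (F' * G))) = (inverse F * F) * (inverse F' * F') * d"
    unfolding d_def h'F'[symmetric] hF[symmetric] by (simp add: algebra_simps)
  also have "\<dots> = d"
    using F F' by (simp add: inverse_mult_eq_1)
  finally have d: "d \<in> pZpX" .
  have d0: "d $ 0 = 0"
    by (simp add: d_def h'_def h0)
  define f where "f = fps_exp 1 oo h"
  have "f oo fps_X ^ p = fps_exp 1 oo h'"
    unfolding f_def h'_def by (rule fps_compose_assoc[OF X h0, symmetric])
  also have "h' = of_nat p * h + d"
    by (simp add: d_def)
  also have "fps_exp 1 oo (of_nat p * h + d) = f ^ p * (fps_exp 1 oo d)"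
    using h0 d0 by (simp add: fps_exp_compose_add fps_exp_compose_of_nat_mult f_def)
  finally have "f \<in> ZpX"
    by (intro dieudonne_dwork[of f "fps_exp 1 oo d"] fps_exp_compose_pZpX d) (simp_all add: f_def)
  thus ?thesis
    by (simp add: f_def h_def)
qed

lemma fps_compose_X_power_mult_nth:
  fixes A C :: "real fps"
  assumes "a < p"
  shows "((A oo fps_X ^ p) * C) $ (a + p * K) = (\<Sum>j\<le>K. A $ (K - j) * C $ (a + p * j))"
proof -
  define n where "n = a + p * K"
  have "((A oo fps_X ^ p) * C) $ n = (\<Sum>i\<in>{0..n}. (if p dvd i then A $ (i div p) else 0) * C $ (n - i))"
    using p_pos by (simp add: fps_mult_nth fps_nth_compose_X_power)
  also have "\<dots> = (\<Sum>i\<in>(\<lambda>j. p * j) ` {..K}. A $ (i div p) * C $ (n - i))"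
  proof (rule sum.mono_neutral_cong_right)
    show "(\<lambda>j. p * j) ` {..K} \<subseteq> {0..n}"
      by (auto simp: n_def trans_le_add2)
    show "\<forall>i\<in>{0..n} - (\<lambda>j. p * j) ` {..K}. (if p dvd i then A $ (i div p) else 0) * C $ (n - i) = 0"
    proof
      fix i assume i: "i \<in> {0..n} - (\<lambda>j. p * j) ` {..K}"
      have "\<not> p dvd i"
      proof
        assume "p dvd i"
        then obtain j where j: "i = p * j"
          by (elim dvdE)
        have "p * j < p * (K + 1)"
          using i assms by (simp add: n_def j)
        hence "j \<le> K"
          by (metis mult_less_cancel1 Suc_eq_plus1 less_Suc_eq_le)
        thus False
          using i j by auto
      qed
      thus "(if p dvd i then A $ (i div p) else 0) * C $ (n - i) = 0"
        by simp
    qed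
  qed auto
  also have "\<dots> = (\<Sum>j\<le>K. A $ j * C $ (n - p * j))"
    using p_pos by (subst sum.reindex) (auto simp: inj_on_def)
  \<comment> \<open>Reversal of the summation brings the indices into the shape of
    \<open>convolution_congruence\<close>.\<close>
  also have "\<dots> = (\<Sum>j\<le>K. A $ (K - j) * C $ (n - p * (K - j)))"
    by (rule sum.reindex_bij_witness[of _ "\<lambda>j. K - j" "\<lambda>j. K - j"]) auto
  also have "\<dots> = (\<Sum>j\<le>K. A $ (K - j) * C $ (a + p * j))"
    by (intro sum.cong refl) (simp add: n_def diff_mult_distrib2 algebra_simps)
  finally show ?thesis
    by (simp add: n_def)
qed

end

subsection \<open>Specialization to the mirror maps\<close>

lemma (in harmonic_dwork) q_series_ZpX:
  assumes "B 0 = 1"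
  shows "fps_exp 1 oo (Abs_fps (\<lambda>m. harm (L * m) * B m) / Abs_fps B) \<in> ZpX"
proof (rule fps_exp_divide_ZpX)
  define F where "F = Abs_fps B"
  define G where "G = Abs_fps (\<lambda>m. harm (L * m) * B m)"
  have "(F * (G oo fps_X ^ p) - of_nat p * ((F oo fps_X ^ p) * G)) $ n \<in> ideal p" for n
  proof -
    define a K where "a = n mod p" and "K = n div p"
    have n: "n = a + p * K" and a: "a < p"
      using p_pos by (auto simp: a_def K_def)
    have "((G oo fps_X ^ p) * F) $ n - real p * ((F oo fps_X ^ p) * G) $ n
      = (\<Sum>j\<le>K. B (a + p * j) * B (K - j) * (harm (L * (K - j)) - real p * harm (L * (a + p * j))))"
      unfolding n fps_compose_X_power_mult_nth[OF a] sum_distrib_left sum_subtractf[symmetric]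
      by (intro sum.cong refl) (simp add: F_def G_def algebra_simps)
    thus ?thesis
      using convolution_congruence[OF a, of K] by (simp add: mult.commute fps_mult_of_nat_nth)
  qed
  thus "Abs_fps B * (Abs_fps (\<lambda>m. harm (L * m) * B m) oo fps_X ^ p) -
      of_nat p * ((Abs_fps B oo fps_X ^ p) * Abs_fps (\<lambda>m. harm (L * m) * B m)) \<in> pZpX"
    by (simp add: pZpX_def F_def G_def)
qed (auto simp: ZpX_def B_Zp assms harm_def)

lemma Ints_if_all_Zp:
  assumes "\<And>p. prime p \<Longrightarrow> x \<in> prime_place.Zp p"
  shows "x \<in> \<int>"
proof -
  have rat: "\<exists>(c::int) (d::nat). \<not> p dvd d \<and> x = of_int c / of_nat d" if "prime p" for p
  proof -
    interpret prime_place p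
      using that by unfold_locales
    show ?thesis
      using assms[OF that] by (simp add: Zp_def)
  qed
  \<comment> \<open>Integrality at a single prime already gives rationality; the other primes then
    exclude every prime factor of the reduced denominator.\<close>
  have "x \<in> \<rat>"
    using rat[OF two_is_prime_nat] by auto
  then obtain a b where ab: "b > 0" "coprime a b" "x = of_int a / of_int b"
    by (elim Rats_cases')
  have "b = 1"
  proof (rule ccontr)
    assume "b \<noteq> 1"
    hence "nat b \<noteq> 1"
      using ab(1) by simp
    then obtain p where p: "prime p" "p dvd nat b"
      using prime_factor_nat by blast
    obtain c d where cd: "\<not> p dvd d" "x = of_int c / real d"
      using rat[OF p(1)] by blast
    have "d > 0"
      using cd(1) by (intro Nat.gr0I) auto
    have "real_of_int (a * int d) = real_of_int (c * b)"
      using ab cd \<open>d > 0\<close> by (simp add: field_simps)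
    hence "a * int d = c * b"
      by (simp only: of_int_eq_iff)
    moreover have "int p dvd b"
    proof -
      have "int p dvd int (nat b)"
        using p(2) by (simp only: int_dvd_int_iff)
      thus ?thesis
        using ab(1) by simp
    qed
    ultimately have "int p dvd a * int d"
      by simp
    hence "int p dvd a"
      using cd(1) p(1) by (simp add: prime_dvd_mult_iff)
    with \<open>int p dvd b\<close> ab(2) have "is_unit (int p)"
      by (meson coprime_common_divisor)
    thus False
      using p(1) by simp
  qed
  thus ?thesis
    by (simp add: ab(3))
qed

theorem theorem5:
  fixes k L :: nat and N :: "nat \<Rightarrow> nat"
  assumes "k \<ge> 1"
    and "\<And>j. j \<in> {1..k} \<Longrightarrow> N j \<ge> 1"
    and "L \<in> {1..Max (N ` {1..k})}"
  shows "\<forall>n. q_fps L k N $ n \<in> \<int>"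
proof (intro allI Ints_if_all_Zp)
  fix n p :: nat
  assume "prime p"
  then interpret prime_place p
    by unfold_locales
  define B where "B m = (\<Prod>j=1..k. B_coeff (N j) m)" for m
  define ratio where "ratio j v R \<longleftrightarrow> lip 1 R \<and> (\<forall>m. B_coeff (N j) (v + p * m) = R m * B_coeff (N j) m)"
    for j v R
  define r where "r j v = (SOME R. ratio j v R)" for j v
  have ex: "\<exists>R. ratio j v R" if "j \<in> {1..k}" "v < p" for j v
    using B_coeff_ratio[OF assms(2)[OF that(1)] that(2)] by (simp only: ratio_def)
  have ratio_r: "ratio j v (r j v)" if "j \<in> {1..k}" "v < p" for j v
    unfolding r_def by (rule someI_ex[of "ratio j v", OF ex[OF that]])
  have r: "lip 1 (r j v)" "B_coeff (N j) (v + p * m) = r j v m * B_coeff (N j) m"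
    if "j \<in> {1..k}" "v < p" for j v m
    using ratio_r[OF that] by (auto simp only: ratio_def)
  have B_at_0: "B 0 = 1"
    by (simp add: B_def B_coeff_def)
  \<comment> \<open>An index attaining the maximum. Its factor alone absorbs the denominators in
    \<open>divide_Zp\<close>; the other factors need only be \<open>p\<close>-integral.\<close>
  obtain i where i: "i \<in> {1..k}" "L \<le> N i"
  proof -
    have "Max (N ` {1..k}) \<in> N ` {1..k}"
      using assms(1) by (intro Max_in) auto
    thus ?thesis
      using that assms(3) by auto
  qed
  \<comment> \<open>The valuation bound with exponent 0.\<close>
  have B_coeff_Zp: "B_coeff (N j) m \<in> Zp" if "j \<in> {1..k}" for j m
    using B_coeff_valuation[of "N j" 0 m] assms(2)[OF that] by simp
  interpret harmonic_dwork p B "\<lambda>v m. \<Prod>j=1..k. r j v m" L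
  proof unfold_locales
    show "B 0 \<in> Zp"
      by (simp add: B_at_0)
    show "lip 1 (\<lambda>m. \<Prod>j=1..k. r j v m)" if "v < p" for v
      using that by (intro lip_prod r)
    show "B (v + p * m) = (\<Prod>j=1..k. r j v m) * B m" if "v < p" for v m
      using that unfolding B_def prod.distrib[symmetric] by (intro prod.cong refl r)
    show "B (a + p * j) / real (p * (L * j + e)) \<in> Zp"
      if "a < p" "e \<ge> 1" "p * e \<le> L * a" for a e j
    proof -
      have "B_coeff (N i) (a + p * j) / real (p * (L * j + e)) * (\<Prod>l\<in>{1..k} - {i}. B_coeff (N l) (a + p * j)) \<in> Zp"
        using that i assms(3) by (intro Zp_mult Zp_prod B_coeff_divide_Zp B_coeff_Zp) auto
      thus ?thesis
        using i(1) by (simp add: B_def prod.remove)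
    qed
  qed
  have "q_fps L k N = fps_exp 1 oo (Abs_fps (\<lambda>m. harm (L * m) * B m) / Abs_fps B)"
    unfolding q_fps_def F_fps_def G_fps_def B_def ..
  thus "q_fps L k N $ n \<in> Zp"
    using q_series_ZpX[OF B_at_0] by (simp add: ZpX_def)
qed

end
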